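(* With $Q:=q^{13}$, the following hold: $$2q^2E(q^2)E(Q^6)U(1,39,q)U(1,39,-q)=(1,1,10)+(2,1,5)-(1,0,39)-(5,2,8),$$ $$2q^2E(q^6)E(Q^2)U(3,13,q)U(3,13,-q)=(3,0,13)+(2,1,5)-(3,3,4)-(5,2,8),$$ $$\frac{(3,0,13)-(5,2,8)}{(1,0,39)+(5,2,8)}=q^3\frac{\psi(-q)\psi(-Q^3)}{\psi(-q^3)\psi(-Q)},$$ $$\frac{(1,1,10)+(2,1,5)-(1,0,39)-(5,2,8)}{(3,0,13)+(2,1,5)-(3,3,4)-(5,2,8)}=\frac{\varphi(-q^6)\varphi(-Q^2)}{\varphi(-q^2)\varphi(-Q^6)}.$$
   Context: Let $|q|<1$, $(a;q)_\infty=\prod_{k\ge0}(1-aq^k)$, $(a;q)_n=\prod_{k=0}^{n-1}(1-aq^k)$. $G(q)=\sum_{n\ge0}\frac{q^{n^2}}{(q;q)_n}$, $H(q)=\sum_{n\ge0}\frac{q^{n(n+1)}}{(q;q)_n}$. For positive integers $r,s$, $U(r,s,q)$ is defined by $U(r,s,q)=G(q^r)G(q^s)+q^{(s+r)/5}H(q^r)H(q^s)$ if $s+r\equiv0\pmod5$ and $U(r,s,q)=H(q^r)G(q^s)-q^{(s-r)/5}G(q^r)H(q^s)$ if $s-r\equiv0\pmod5$; $U(r,s,x)$ denotes this expression with $q$ replaced by $x$ (e.g. $x=-q$). $E(q)=(q;q)_\infty$, $\varphi(q)=\sum_{n\in\mathbb Z}q^{n^2}$, $\psi(q)=\sum_{n\ge0}q^{n(n+1)/2}$.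 For integers $a,b,c$ with $a,c>0$, $b^2-4ac<0$, the symbol $(a,b,c)$ denotes the theta series $\sum_{n,m=-\infty}^{\infty}q^{an^2+bnm+cm^2}$. *)

theory Defs
  imports "HOL-Analysis.Analysis"
begin

definition qpoch :: "complex \<Rightarrow> complex \<Rightarrow> nat \<Rightarrow> complex" where
  "qpoch a q n = (\<Prod>k<n. 1 - a * q ^ k)"

definition qpoch_inf :: "complex \<Rightarrow> complex \<Rightarrow> complex" where
  "qpoch_inf a q = (\<Prod>k. 1 - a * q ^ k)"

definition euler_E :: "complex \<Rightarrow> complex" where
  "euler_E q = qpoch_inf q q"

definition rr_G :: "complex \<Rightarrow> complex" where
  "rr_G q = (\<Sum>n. q ^ (n ^ 2) / qpoch q q n)"

definition rr_H :: "complex \<Rightarrow> complex" where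
  "rr_H q = (\<Sum>n. q ^ (n * (n + 1)) / qpoch q q n)"

text \<open>
  The two cases overlap only when 5 divides both parameters; the first one is then taken.
  In the second case the exponent may be negative, hence the integer power.
\<close>

definition rr_U :: "nat \<Rightarrow> nat \<Rightarrow> complex \<Rightarrow> complex" where
  "rr_U r s q =
    (if (s + r) mod 5 = 0 then
       rr_G (q ^ r) * rr_G (q ^ s) + q ^ ((s + r) div 5) * rr_H (q ^ r) * rr_H (q ^ s)
     else if (int s - int r) mod 5 = 0 then
       rr_H (q ^ r) * rr_G (q ^ s)
         - q powi ((int s - int r) div 5) * rr_G (q ^ r) * rr_H (q ^ s)
     else undefined)"

definition ram_phi :: "complex \<Rightarrow> complex" where
  "ram_phi q = (\<Sum>\<^sub>\<infinity>n\<in>(UNIV :: int set). q powi (n ^ 2))"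

definition ram_psi :: "complex \<Rightarrow> complex" where
  "ram_psi q = (\<Sum>n. q ^ (n * (n + 1) div 2))"

text \<open>
  The theta series of the binary quadratic form (a,b,c), meant for positive definite forms:
  the exponents are then nonnegative and the series converges absolutely for \<open>norm q < 1\<close>.
\<close>

definition theta_form :: "int \<Rightarrow> int \<Rightarrow> int \<Rightarrow> complex \<Rightarrow> complex" where
  "theta_form a b c q =
    (\<Sum>\<^sub>\<infinity>(n, m)\<in>(UNIV :: (int \<times> int) set). q powi (a * n ^ 2 + b * n * m + c * m ^ 2))"

end

theory Submission
  imports Defs
begin

text \<open>
  By the Rogers-Ramanujan identities and the Jacobi triple product, the products
  \<open>E(q\<^sup>2)G(q)G(-q)\<close>, \<open>E(q\<^sup>2)H(q)H(-q)\<close>, \<open>E(q\<^sup>2)G(q)H(q\<^sup>4)\<close> and \<open>E(q\<^sup>2)H(q)G(q\<^sup>4)\<close> are single theta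
  functions, while \<open>2E(q\<^sup>2)G(q)G(q\<^sup>4) = \<phi>(q) + \<phi>(q\<^sup>5)\<close>, \<open>2qE(q\<^sup>2)H(q)H(q\<^sup>4) = \<phi>(q) - \<phi>(q\<^sup>5)\<close> and
  \<open>E(q\<^sup>2)G(q)H(-q) = \<psi>(q\<^sup>2) + q\<psi>(q\<^bsup>10\<^esup>)\<close>. Hence the products \<open>U(r,s,q)U(r,s,-q)\<close> and
  \<open>U(r,s,q)U(r,s,q\<^sup>4)\<close>, multiplied by suitable values of \<open>E\<close>, expand into sums of products of two
  theta functions, which are regrouped into theta series of binary forms by splitting the lattice
  into residue classes modulo 2 and 5. This gives the first two identities and, in the form
  \<open>(1,0,39) + (5,2,8) = 2E(q\<^sup>2)E(Q\<^sup>6)U(1,39,q)U(1,39,q\<^sup>4)\<close> and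
  \<open>(3,0,13) - (5,2,8) = 2q\<^sup>3E(q\<^sup>6)E(Q\<^sup>2)U(3,13,q)U(3,13,q\<^sup>4)\<close>, the third one. The quotients in the last
  two identities are then evaluated by Ramanujan's relation
  \<open>E(q)E(Q\<^sup>3)U(1,39,q) = E(q\<^sup>3)E(Q)U(3,13,q)\<close>, whose two sides are the same signed lattice sum.
\<close>

subsection \<open>Infinite sums\<close>

text \<open>The delicate ingredient is \<open>G(q)G(q^4)\<close>, a sum of two thetas rather than a
  product. A lattice sum gives \<open>G(q)G(q^4) + q H(q)H(q^4)\<close>; the product of its two
  terms regroups as \<open>G(q)H(q^4)\<close> times \<open>q H(q)G(q^4)\<close>, so the square of
  their difference is known too. Only a sign is left open, and continuity up to the origin decides
  it. The value of \<open>G(q)H(-q)\<close> then comes from dissecting the theta function of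
  \<open>G(s)H(s^4)\<close>, \<open>s^4 = q\<close>, by parity. The forms have discriminants -39 and
  -156: up to a change of basis, (1,0,39), (3,0,13) and (5,2,8) are (1,1,10), (3,3,4) and (2,1,5)
  restricted to one even coordinate. So the right sides of the first two identities are, up to sign,
  sums over points with that coordinate odd. The link between the two functions U is that
  \<open>20(2x^2 + xk + 5k^2)\<close> equals both \<open>(10k + x)^2 + 39x^2\<close> and
  \<open>3(3x + 4k)^2 + 13(x - 2k)^2\<close>. The thetas of G and H have exponents
  \<open>n(5n+1)/2\<close> and \<open>n(5n+3)/2\<close>; therefore much of the work is done in a
  square root \<open>t\<close> of \<open>q\<close>.\<close>

lemma infsum_tendsto_dominated:
  fixes f :: "'a \<Rightarrow> 'b \<Rightarrow> complex"
  assumes lim: "\<And>x. ((\<lambda>n. f n x) \<longlongrightarrow> g x) F"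
    and bound: "eventually (\<lambda>n. \<forall>x. norm (f n x) \<le> M x) F"
    and M: "M summable_on UNIV"
  shows "((\<lambda>n. infsum (f n) UNIV) \<longlongrightarrow> infsum g UNIV) F"
proof (cases "F = bot")
  case False
  have gM: "norm (g x) \<le> M x" for x
  proof (rule tendsto_upperbound[OF tendsto_norm[OF lim[of x]] _ False])
    show "eventually (\<lambda>n. norm (f n x) \<le> M x) F"
      using bound by eventually_elim auto
  qed
  have summ: "h summable_on X" if "\<And>x. norm (h x) \<le> M x" for h :: "'b \<Rightarrow> complex" and X
    using Infinite_Sum.abs_summable_on_comparison_test'[OF M, of h] that
    by (metis abs_summable_summable summable_on_subset_banach top_greatest)
  have M0: "0 \<le> M x" for x
    using gM[of x] norm_ge_zero order_trans by blast
  have summM: "M summable_on X" for X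
    using M summable_on_subset_banach by blast
  show ?thesis
  proof (rule tendstoI)
    fix e :: real assume e: "e > 0"
    \<comment> \<open>Two tails of at most \<open>e / 4\<close> each leave \<open>e / 2\<close> for
      the finite part.\<close>
    obtain X where X: "finite X" and XM: "dist (sum M X) (infsum M UNIV) \<le> e / 4"
      using infsum_finite_approximation[OF M, of "e / 4"] e by auto
    have tail: "infsum M (-X) \<le> e / 4"
    proof -
      have "infsum M (X \<union> -X) = infsum M X + infsum M (-X)"
        by (rule infsum_Un_disjoint) (auto simp: summM X)
      moreover have "infsum M X = sum M X" using X by simp
      ultimately show ?thesis using XM by (simp add: dist_real_def)
    qed
    have tl: "norm (infsum h (-X)) \<le> e / 4" if "\<And>x. norm (h x) \<le> M x" for h :: "'b \<Rightarrow> complex"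
    proof -
      have "norm (infsum h (-X)) \<le> infsum M (-X)"
        by (rule norm_infsum_le[OF has_sum_infsum has_sum_infsum]) (use that summ summM in auto)
      with tail show ?thesis by linarith
    qed
    have split: "infsum h UNIV = sum h X + infsum h (-X)" if "\<And>x. norm (h x) \<le> M x"
      for h :: "'b \<Rightarrow> complex"
    proof -
      have "infsum h (X \<union> -X) = infsum h X + infsum h (-X)"
        by (rule infsum_Un_disjoint) (use that summ in auto)
      then show ?thesis using X by simp
    qed
    have "((\<lambda>n. sum (f n) X) \<longlongrightarrow> sum g X) F"
      by (intro tendsto_sum lim)
    then have "eventually (\<lambda>n. dist (sum (f n) X) (sum g X) < e / 2) F"
      using e by (intro tendstoD) auto
    with bound show "eventually (\<lambda>n. dist (infsum (f n) UNIV) (infsum g UNIV) < e) F"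
    proof eventually_elim
      case (elim n)
      have "infsum (f n) UNIV - infsum g UNIV
          = (sum (f n) X - sum g X) + (infsum (f n) (-X) - infsum g (-X))"
        using split[of "f n"] split[of g] elim gM by simp
      also have "norm \<dots> \<le> norm (sum (f n) X - sum g X) + (norm (infsum (f n) (-X)) + norm (infsum g (-X)))"
        by (rule norm_triangle_mono) (auto intro: norm_triangle_ineq4)
      also have "\<dots> < e"
        using elim(2) tl[of "f n"] tl[of g] elim(1) gM by (fastforce simp: dist_norm)
      finally show ?case by (simp add: dist_norm)
    qed
  qed
qed auto

lemma summable_on_prod_mult:
  fixes f :: "'a \<Rightarrow> complex" and g :: "'b \<Rightarrow> complex"
  assumes f: "f summable_on UNIV" and g: "g summable_on UNIV"
  shows "(\<lambda>(i, j). f i * g j) summable_on UNIV"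
proof -
  have nf: "(\<lambda>i. norm (f i)) summable_on UNIV" and ng: "(\<lambda>j. norm (g j)) summable_on UNIV"
    using f g summable_on_iff_abs_summable_on_complex by blast+
  have "(\<lambda>x. norm ((\<lambda>(i, j). f i * g j) x)) summable_on Sigma UNIV (\<lambda>_. UNIV)"
    unfolding Infinite_Sum.abs_summable_on_Sigma_iff
    using nf ng by (auto simp: norm_mult infsum_cmult_right' abs_mult intro!: summable_on_cmult_right summable_on_cmult_left)
  then show ?thesis
    using abs_summable_summable by (fastforce simp: case_prod_unfold)
qed

lemma infsum_prod_mult:
  fixes f :: "'a \<Rightarrow> complex" and g :: "'b \<Rightarrow> complex"
  assumes f: "f summable_on UNIV" and g: "g summable_on UNIV"
  shows "infsum (\<lambda>(i, j). f i * g j) UNIV = infsum f UNIV * infsum g UNIV"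
proof -
  have "infsum (\<lambda>(i, j). f i * g j) (UNIV \<times> UNIV)
      = infsum (\<lambda>i. infsum (\<lambda>j. f i * g j) UNIV) UNIV"
    using infsum_Sigma_banach[of "\<lambda>(i, j). f i * g j" UNIV "\<lambda>_. UNIV"] summable_on_prod_mult[OF f g] by simp
  also have "\<dots> = infsum f UNIV * infsum g UNIV"
    by (simp add: infsum_cmult_right' infsum_cmult_left')
  finally show ?thesis by simp
qed

lemma summable_on_geometric_int:
  fixes s :: real
  assumes "0 \<le> s" "s < 1"
  shows "(\<lambda>n::int. s ^ nat \<bar>n\<bar>) summable_on UNIV"
proof -
  have *: "(\<lambda>n::nat. s ^ n) summable_on UNIV"
    using assms by (intro norm_summable_imp_summable_on) (auto simp: summable_geometric)
  have 1: "(\<lambda>n::int. s ^ nat \<bar>n\<bar>) summable_on {0..}"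
    using * by (subst summable_on_reindex_bij_witness[of _ int nat UNIV "\<lambda>n. s ^ n"]) auto
  have 2: "(\<lambda>n::int. s ^ nat \<bar>n\<bar>) summable_on {..0}"
    using * by (subst summable_on_reindex_bij_witness[of _ "\<lambda>n. - int n" "\<lambda>n. nat (-n)" UNIV "\<lambda>n. s ^ n"]) auto
  have "(\<lambda>n::int. s ^ nat \<bar>n\<bar>) summable_on ({0..} \<union> ({..0} - {0..}))"
    using 1 2 by (intro summable_on_Un_disjoint) (auto intro: summable_on_subset_banach)
  moreover have "({0..} \<union> ({..0} - {0..})) = (UNIV :: int set)" by auto
  ultimately show ?thesis by simp
qed

text \<open>A form bounds \<open>n^2 + m^2\<close> only up to a factor \<open>K\<close>; the
  \<open>K\<close>-th root of \<open>r\<close> absorbs this factor and leaves a geometric majorant.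
  The constant \<open>C\<close> makes room for a linear term in the exponent.\<close>

lemma power_int_le_root_power:
  fixes r :: real
  assumes r: "0 < r" "r < 1" and K: "K > 0" and le: "int w \<le> int K * e + int C"
  shows "r powi e \<le> (1 / root K r ^ C) * root K r ^ w"
proof -
  define s where "s = root K r"
  have s: "0 < s" "s < 1" "s ^ K = r"
    using r K by (auto simp: s_def)
  have "r powi e = s powi (int K * e)"
    using s by (simp add: power_int_power flip: s(3))
  also have "\<dots> \<le> s powi (int w - int C)"
    using s le by (intro power_int_decreasing) auto
  also have "\<dots> = (1 / s ^ C) * s ^ w"
    using s by (simp add: power_int_diff)
  finally show ?thesis by (simp add: s_def)
qed

lemma summable_on_powi_int:
  fixes q :: complex and c :: "int \<Rightarrow> complex"
  assumes q: "q \<noteq> 0" "norm q < 1" and K: "K > 0" and c: "\<And>n. norm (c n) \<le> 1"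
    and le: "\<And>n. \<bar>n\<bar> \<le> int K * e n + int C"
  shows "(\<lambda>n. c n * q powi e n) summable_on UNIV"
proof -
  define s where "s = root K (norm q)"
  have s: "0 \<le> s" "s < 1" using q K by (auto simp: s_def)
  have "(\<lambda>n. norm (c n * q powi e n)) summable_on UNIV"
  proof (rule Infinite_Sum.abs_summable_on_comparison_test')
    show "(\<lambda>n::int. (1 / s ^ C) * s ^ nat \<bar>n\<bar>) summable_on UNIV"
      using summable_on_geometric_int[OF s] by (rule summable_on_cmult_right)
    fix n
    have "norm (c n * q powi e n) \<le> norm q powi e n"
      using c[of n] by (simp add: norm_mult norm_power_int mult_left_le_one_le)
    also have "\<dots> \<le> (1 / s ^ C) * s ^ nat \<bar>n\<bar>"
      unfolding s_def using q K le[of n] by (intro power_int_le_root_power) auto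
    finally show "norm (c n * q powi e n) \<le> (1 / s ^ C) * s ^ nat \<bar>n\<bar>" .
  qed
  then show ?thesis using summable_on_iff_abs_summable_on_complex by blast
qed

lemma abs_le_square_int: "\<bar>n\<bar> \<le> n\<^sup>2" for n :: int
  using self_le_power[of "\<bar>n\<bar>" 2] by (cases "n = 0") auto

lemma summable_on_powi_int2:
  fixes q :: complex and c :: "int \<times> int \<Rightarrow> complex"
  assumes q: "q \<noteq> 0" "norm q < 1" and K: "K > 0" and c: "\<And>x. norm (c x) \<le> 1"
    and le: "\<And>n m. n\<^sup>2 + m\<^sup>2 \<le> int K * e (n, m)"
  shows "(\<lambda>x. c x * q powi e x) summable_on UNIV"
proof -
  define s where "s = root K (norm q)"
  have s: "0 \<le> s" "s < 1" using q K by (auto simp: s_def)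
  have "(\<lambda>x. norm (c x * q powi e x)) summable_on UNIV"
  proof (rule Infinite_Sum.abs_summable_on_comparison_test')
    have "(\<lambda>n::int. complex_of_real (s ^ nat \<bar>n\<bar>)) summable_on UNIV"
      using summable_on_geometric_int[OF s] summable_on_of_real by blast
    from summable_on_prod_mult[OF this this]
    have "(\<lambda>x. norm ((\<lambda>(n, m). complex_of_real (s ^ nat \<bar>n\<bar>) * complex_of_real (s ^ nat \<bar>m\<bar>)) x)) summable_on (UNIV :: (int \<times> int) set)"
      using summable_on_iff_abs_summable_on_complex by blast
    also have "(\<lambda>x. norm ((\<lambda>(n, m). complex_of_real (s ^ nat \<bar>n\<bar>) * complex_of_real (s ^ nat \<bar>m\<bar>)) x)) 
       = (\<lambda>(n::int, m::int). s ^ nat \<bar>n\<bar> * s ^ nat \<bar>m\<bar>)"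
      using s by (auto simp: norm_mult norm_power fun_eq_iff)
    finally show "(\<lambda>(n::int, m::int). s ^ nat \<bar>n\<bar> * s ^ nat \<bar>m\<bar>) summable_on UNIV" .
    fix x :: "int \<times> int"
    obtain n m where x: "x = (n, m)" by (cases x)
    have "norm (c x * q powi e x) \<le> norm q powi e x"
      using c[of x] by (simp add: norm_mult norm_power_int mult_left_le_one_le)
    also have "\<dots> \<le> (1 / s ^ 0) * s ^ (nat \<bar>n\<bar> + nat \<bar>m\<bar>)"
      unfolding s_def using q K le[of n m] abs_le_square_int[of n] abs_le_square_int[of m]
      by (intro power_int_le_root_power) (auto simp: x)
    finally show "norm (c x * q powi e x) \<le> (\<lambda>(n::int, m::int). s ^ nat \<bar>n\<bar> * s ^ nat \<bar>m\<bar>) x"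
      by (simp add: x power_add)
  qed
  then show ?thesis using summable_on_iff_abs_summable_on_complex by blast
qed

subsection \<open>Infinite products\<close>

lemma convergent_prod_qpoch:
  fixes a q :: complex
  assumes "norm q < 1"
  shows "convergent_prod (\<lambda>k. 1 - a * q ^ k)"
proof -
  have "summable (\<lambda>k. norm (1 - a * q ^ k - 1))"
    using assms by (simp add: norm_mult norm_power summable_mult summable_geometric)
  then show ?thesis
    using abs_convergent_prod_conv_summable abs_convergent_prod_imp_convergent_prod by blast
qed

lemma qpoch_tendsto:
  assumes "norm q < 1"
  shows "(\<lambda>n. qpoch a q n) \<longlonglongrightarrow> qpoch_inf a q"
  unfolding qpoch_def qpoch_inf_def
  using has_prod_imp_tendsto'[OF convergent_prod_has_prod[OF convergent_prod_qpoch[OF assms]]] .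

lemma one_minus_mult_power_nonzero:
  fixes a q :: complex
  assumes "norm q < 1" "norm a < 1"
  shows "1 - a * q ^ k \<noteq> 0"
proof -
  have "norm (a * q ^ k) \<le> norm a * 1"
    unfolding norm_mult norm_power using assms by (intro mult_left_mono power_le_one) auto
  with assms have "norm (a * q ^ k) < 1" by simp
  then have "a * q ^ k \<noteq> 1" by auto
  then show ?thesis by simp
qed

lemma qpoch_nonzero:
  assumes "norm q < 1" "norm a < 1"
  shows "qpoch a q n \<noteq> 0"
  using one_minus_mult_power_nonzero[OF assms] by (simp add: qpoch_def)

lemma qpoch_inf_nonzero:
  assumes "norm q < 1" "norm a < 1"
  shows "qpoch_inf a q \<noteq> 0"
  unfolding qpoch_inf_def
  using prodinf_nonzero[OF convergent_prod_qpoch[OF assms(1)]] one_minus_mult_power_nonzero[OF assms] by blast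

lemma qpoch_inf_square:
  assumes "norm q < 1"
  shows "qpoch_inf (a\<^sup>2) (q\<^sup>2) = qpoch_inf a q * qpoch_inf (- a) q"
proof -
  have "qpoch_inf a q * qpoch_inf (- a) q = (\<Prod>k. (1 - a * q ^ k) * (1 - (- a) * q ^ k))"
    unfolding qpoch_inf_def by (intro prodinf_mult convergent_prod_qpoch assms)
  also have "\<dots> = qpoch_inf (a\<^sup>2) (q\<^sup>2)"
    unfolding qpoch_inf_def
    by (intro prodinf_cong) (simp add: algebra_simps power2_eq_square power_mult_distrib)
  finally show ?thesis by simp
qed

text \<open>The partial product of \<open>n * m\<close> factors, cut into blocks of length
  \<open>m\<close>, is a product of \<open>m\<close> partial products of \<open>n\<close> factors;
  both sides are limits of this one sequence.\<close>

lemma qpoch_inf_multisection: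
  assumes q: "norm q < 1" and m: "m > 0"
  shows "qpoch_inf a q = (\<Prod>j<m. qpoch_inf (a * q ^ j) (q ^ m))"
proof (rule LIMSEQ_unique)
  have qm: "norm (q ^ m) < 1"
    using q m by (simp add: norm_power power_less_one_iff)
  show "(\<lambda>n. \<Prod>j<m. qpoch (a * q ^ j) (q ^ m) n) \<longlonglongrightarrow> (\<Prod>j<m. qpoch_inf (a * q ^ j) (q ^ m))"
    by (intro tendsto_prod qpoch_tendsto qm)
  have "(\<Prod>j<m. qpoch (a * q ^ j) (q ^ m) n) = qpoch a q (n * m)" for n
  proof -
    have "qpoch a q (n * m) = (\<Prod>k<n. \<Prod>i\<in>{k * m..<k * m + m}. 1 - a * q ^ i)"
      unfolding qpoch_def by (rule prod.nat_group[symmetric])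
    also have "\<dots> = (\<Prod>k<n. \<Prod>j<m. 1 - (a * q ^ j) * (q ^ m) ^ k)"
    proof (rule prod.cong[OF refl])
      fix k
      show "(\<Prod>i\<in>{k * m..<k * m + m}. 1 - a * q ^ i) = (\<Prod>j<m. 1 - (a * q ^ j) * (q ^ m) ^ k)"
        by (rule prod.reindex_bij_witness[of _ "\<lambda>j. k * m + j" "\<lambda>i. i - k * m"])
           (auto simp: mult_ac simp flip: power_add power_mult)
    qed
    also have "\<dots> = (\<Prod>j<m. qpoch (a * q ^ j) (q ^ m) n)"
      unfolding qpoch_def by (rule prod.swap)
    finally show ?thesis by simp
  qed
  moreover have "(\<lambda>n. qpoch a q (n * m)) \<longlonglongrightarrow> qpoch_inf a q"
    using m by (intro filterlim_compose[OF qpoch_tendsto[OF q]] mult_nat_right_at_top) auto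
  ultimately show "(\<lambda>n. \<Prod>j<m. qpoch (a * q ^ j) (q ^ m) n) \<longlonglongrightarrow> qpoch_inf a q"
    by simp
qed

subsection \<open>Gaussian binomial coefficients\<close>

text \<open>An integer index with value zero outside \<open>0..n\<close> lets sums run over all
  integers and be shifted or reflected without boundary terms.\<close>

definition gbin :: "complex \<Rightarrow> nat \<Rightarrow> int \<Rightarrow> complex" where
  "gbin q n k = (if 0 \<le> k \<and> k \<le> int n
     then qpoch q q n / (qpoch q q (nat k) * qpoch q q (n - nat k)) else 0)"

lemma qpoch_0 [simp]: "qpoch a q 0 = 1"
  by (simp add: qpoch_def)

lemma qpoch_Suc: "qpoch q q (Suc n) = qpoch q q n * (1 - q ^ Suc n)"
  by (simp add: qpoch_def)

lemma gbin_add: "gbin q (i + j) (int i) = qpoch q q (i + j) / (qpoch q q i * qpoch q q j)"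
  by (simp add: gbin_def)

lemma gbin_0: "gbin q 0 k = (if k = 0 then 1 else 0)"
  by (auto simp: gbin_def)

lemma gbin_symmetric: "gbin q n (int n - k) = gbin q n k"
proof (cases "0 \<le> k \<and> k \<le> int n")
  case True
  then have "nat (int n - k) = n - nat k" "n - (n - nat k) = nat k" by auto
  with True show ?thesis by (simp add: gbin_def)
qed (auto simp: gbin_def)

lemma gbin_pascal:
  assumes q: "norm q < 1"
  shows "gbin q (Suc n) k = gbin q n (k - 1) + q powi k * gbin q n k"
proof -
  note nz = qpoch_nonzero[OF q q]
  consider "k < 0" | "k = 0" | "k = int n + 1" | "k > int n + 1" | "1 \<le> k" "k \<le> int n" by linarith
  then show ?thesis
  proof cases
    case 5
    define i where "i = nat k - 1"
    define j where "j = n - nat k"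
    have k: "k = int (Suc i)" and n: "n = Suc (i + j)" using 5 by (auto simp: i_def j_def)
    have 1: "gbin q (Suc n) k = qpoch q q (Suc n) / (qpoch q q (Suc i) * qpoch q q (Suc j))"
      using gbin_add[of q "Suc i" "Suc j"] by (simp add: k n)
    have 2: "gbin q n (k - 1) = qpoch q q n / (qpoch q q i * qpoch q q (Suc j))"
      using gbin_add[of q "i" "Suc j"] by (simp add: k n)
    have 3: "gbin q n k = qpoch q q n / (qpoch q q (Suc i) * qpoch q q j)"
      using gbin_add[of q "Suc i" "j"] by (simp add: k n)
    have nz': "1 - q ^ Suc m \<noteq> 0" for m
      using one_minus_mult_power_nonzero[OF q q, of m] by simp
    have "gbin q n (k - 1) + q ^ Suc i * gbin q n k
      = qpoch q q n * ((1 - q ^ Suc i) + q ^ Suc i * (1 - q ^ Suc j)) / (qpoch q q (Suc i) * qpoch q q (Suc j))"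
      unfolding 2 3 qpoch_Suc using nz nz' by (simp add: divide_simps) (simp add: algebra_simps)
    also have "(1 - q ^ Suc i) + q ^ Suc i * (1 - q ^ Suc j) = 1 - q ^ Suc n"
      by (simp add: n algebra_simps power_add)
    finally show ?thesis
      unfolding 1 qpoch_Suc[of q n] using k by (metis power_int_of_nat)
  qed (use nz in \<open>auto simp: gbin_def nat_add_distrib\<close>)
qed

lemma gbin_pascal':
  assumes q: "norm q < 1"
  shows "gbin q (Suc n) k = gbin q n k + q powi (int n + 1 - k) * gbin q n (k - 1)"
proof -
  have "gbin q (Suc n) k = gbin q (Suc n) (int n + 1 - k)"
    using gbin_symmetric[of q "Suc n" k] by (simp add: algebra_simps)
  also have "\<dots> = gbin q n (int n - k) + q powi (int n + 1 - k) * gbin q n (int n - (k - 1))"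
    using gbin_pascal[OF q, of n "int n + 1 - k"] by (simp add: algebra_simps)
  finally show ?thesis by (simp only: gbin_symmetric)
qed

text \<open>The factor on the left is the one by which \<open>qpoch q q (n + 1 - k)\<close> exceeds
  \<open>qpoch q q (n - k)\<close>. At \<open>k = n + 1\<close> it is \<open>1 - q^0 = 0\<close>, in
  agreement with the vanishing coefficient on the right.\<close>

lemma gbin_Suc_absorb:
  assumes q: "norm q < 1"
  shows "(1 - q powi (int n + 1 - k)) * gbin q (Suc n) k = (1 - q ^ Suc n) * gbin q n k"
proof (cases "0 \<le> k \<and> k \<le> int n")
  case True
  define i where "i = nat k"
  define j where "j = n - nat k"
  have k: "k = int i" and n: "n = i + j" using True by (auto simp: i_def j_def)
  have 1: "gbin q (Suc n) k = qpoch q q (Suc n) / (qpoch q q i * qpoch q q (Suc j))"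
    using gbin_add[of q i "Suc j"] by (simp add: k n)
  have 2: "gbin q n k = qpoch q q n / (qpoch q q i * qpoch q q j)"
    using gbin_add[of q i j] by (simp add: k n)
  have 3: "q powi (int n + 1 - k) = q ^ Suc j"
    using power_int_of_nat[of q "Suc j"] by (simp add: k n algebra_simps)
  have "1 - q ^ Suc j \<noteq> 0"
    using one_minus_mult_power_nonzero[OF q q, of j] by simp
  then show ?thesis
    unfolding 1 2 3 qpoch_Suc using qpoch_nonzero[OF q q] by (simp add: divide_simps)
next
  case False
  then consider "k < 0 \<or> k > int n + 1" | "k = int n + 1" by linarith
  then show ?thesis by cases (auto simp: gbin_def)
qed

text \<open>Both \<open>qpoch q q n\<close> and its inverse converge, since
  \<open>qpoch_inf q q\<close> is nonzero. The uniform bound serves as majorant when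
  \<open>n\<close> tends to infinity in the finite identities.\<close>

lemma gbin_bounded:
  assumes q: "norm q < 1"
  obtains C where "C \<ge> 0" "\<And>n k. norm (gbin q n k) \<le> C"
proof -
  have lim: "(\<lambda>n. qpoch q q n) \<longlonglongrightarrow> qpoch_inf q q" by (rule qpoch_tendsto[OF q])
  have "(\<lambda>n. inverse (qpoch q q n)) \<longlonglongrightarrow> inverse (qpoch_inf q q)"
    by (intro tendsto_inverse lim qpoch_inf_nonzero q)
  from convergent_imp_Bseq[OF convergentI[OF this]]
  obtain B where B: "B > 0" "\<And>n. norm (inverse (qpoch q q n)) \<le> B"
    by (auto elim: BseqE)
  from convergent_imp_Bseq[OF convergentI[OF lim]]
  obtain A where A: "A > 0" "\<And>n. norm (qpoch q q n) \<le> A"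
    by (auto elim: BseqE)
  have "norm (gbin q n k) \<le> A * (B * B)" for n k
  proof (cases "0 \<le> k \<and> k \<le> int n")
    case True
    then have "norm (gbin q n k) = norm (qpoch q q n) *
        (norm (inverse (qpoch q q (nat k))) * norm (inverse (qpoch q q (n - nat k))))"
      by (simp add: gbin_def norm_divide norm_mult norm_inverse divide_simps)
    also have "\<dots> \<le> A * (B * B)"
      using A B by (intro mult_mono) auto
    finally show ?thesis .
  qed (use A B in \<open>auto simp: gbin_def\<close>)
  moreover have "A * (B * B) \<ge> 0" using A B by simp
  ultimately show ?thesis using that by blast
qed

lemma gbin_tendsto_central:
  assumes q: "norm q < 1"
  shows "(\<lambda>n. gbin q (2 * n + c) (int n + j)) \<longlonglongrightarrow> 1 / qpoch_inf q q"
proof -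
  note L = qpoch_tendsto[OF q, of q]
  have 1: "filterlim (\<lambda>n. 2 * n + c) at_top sequentially"
    by (rule filterlim_at_top_mono[OF filterlim_ident]) auto
  have 2: "filterlim (\<lambda>n. nat (int n + j)) at_top sequentially"
    unfolding filterlim_at_top
  proof
    fix Z show "eventually (\<lambda>n. Z \<le> nat (int n + j)) sequentially"
      using eventually_ge_at_top[of "Z + nat \<bar>j\<bar>"] by eventually_elim linarith
  qed
  have 3: "filterlim (\<lambda>n. 2 * n + c - nat (int n + j)) at_top sequentially"
    unfolding filterlim_at_top
  proof
    fix Z show "eventually (\<lambda>n. Z \<le> 2 * n + c - nat (int n + j)) sequentially"
      using eventually_ge_at_top[of "Z + nat \<bar>j\<bar>"] by eventually_elim linarith
  qed
  have "(\<lambda>n. qpoch q q (2 * n + c) / (qpoch q q (nat (int n + j)) * qpoch q q (2 * n + c - nat (int n + j))))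
      \<longlonglongrightarrow> qpoch_inf q q / (qpoch_inf q q * qpoch_inf q q)"
    using qpoch_inf_nonzero[OF q q]
    by (intro tendsto_divide tendsto_mult filterlim_compose[OF L 1] filterlim_compose[OF L 2] filterlim_compose[OF L 3]) auto
  moreover have "eventually (\<lambda>n. qpoch q q (2 * n + c) / (qpoch q q (nat (int n + j)) * qpoch q q (2 * n + c - nat (int n + j)))
        = gbin q (2 * n + c) (int n + j)) sequentially"
    using eventually_ge_at_top[of "nat \<bar>j\<bar>"] by eventually_elim (auto simp: gbin_def)
  ultimately show ?thesis
    using qpoch_inf_nonzero[OF q q] by (simp add: filterlim_cong tendsto_cong)
qed

lemma gbin_tendsto:
  assumes q: "norm q < 1"
  shows "(\<lambda>n. gbin q n (int j)) \<longlonglongrightarrow> 1 / qpoch q q j"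
proof -
  note L = qpoch_tendsto[OF q, of q]
  have "(\<lambda>n. qpoch q q n / (qpoch q q j * qpoch q q (n - j))) \<longlonglongrightarrow> qpoch_inf q q / (qpoch q q j * qpoch_inf q q)"
    using qpoch_inf_nonzero[OF q q] qpoch_nonzero[OF q q]
    by (intro tendsto_intros L filterlim_compose[OF L filterlim_minus_const_nat_at_top]) auto
  moreover have "eventually (\<lambda>n. qpoch q q n / (qpoch q q j * qpoch q q (n - j)) = gbin q n (int j)) sequentially"
    using eventually_ge_at_top[of j] by eventually_elim (auto simp: gbin_def)
  ultimately show ?thesis
    using qpoch_inf_nonzero[OF q q] by (simp add: filterlim_cong tendsto_cong)
qed

lemma summable_on_gbin:
  fixes g :: "int \<Rightarrow> complex"
  assumes "d \<noteq> 0"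
  shows "(\<lambda>r. gbin q n (c + d * r) * g r) summable_on UNIV"
proof (rule finite_nonzero_values_imp_summable_on)
  have "inj (\<lambda>r. c + d * r)" using assms by (auto simp: inj_on_def)
  then have "finite ((\<lambda>r. c + d * r) -` {0..int n})" by (intro finite_vimageI) auto
  then show "finite {r \<in> UNIV. gbin q n (c + d * r) * g r \<noteq> 0}"
    by (rule rev_finite_subset) (auto simp: gbin_def split: if_splits)
qed

lemma summable_on_gbin1:
  fixes g :: "int \<Rightarrow> complex"
  shows "(\<lambda>r. gbin q n (c + r) * g r) summable_on UNIV"
  using summable_on_gbin[of 1 q n c g] by simp

subsection \<open>The Jacobi triple product\<close>

text \<open>The weights \<open>w\<close> stand for \<open>p\<^bsup>j(j-1)/2\<^esup> \<alpha>\<^sup>j\<close>; the recurrence avoids halving exponents.\<close>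

lemma jacobi_triple_product_finite:
  fixes w :: "int \<Rightarrow> complex"
  assumes p: "p \<noteq> 0" "norm p < 1" and ab: "\<alpha> * \<beta> = p"
    and w0: "w 0 = 1" and step: "\<And>j. w (j + 1) = w j * p powi j * \<alpha>"
  shows "infsum (\<lambda>j. gbin p (2 * n) (int n + j) * w j) UNIV = qpoch (- \<alpha>) p n * qpoch (- \<beta>) p n"
proof (induction n)
  case 0
  have "infsum (\<lambda>j. gbin p 0 j * w j) UNIV = infsum (\<lambda>j. gbin p 0 j * w j) {0}"
    by (rule infsum_cong_neutral) (auto simp: gbin_0)
  then show ?case by (simp add: gbin_0 w0)
next
  case (Suc n)
  define W where "W = infsum (\<lambda>j. gbin p (2 * n) (int n + j) * w j) UNIV"
  define V where "V = infsum (\<lambda>j. gbin p (2 * n + 1) (int n + j) * w j) UNIV"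
  note sm = summable_on_gbin1
  \<comment> \<open>The Pascal step from \<open>2n\<close> to \<open>2n + 1\<close> contributes the
    factor \<open>1 + \<alpha> p^n\<close>, because the recurrence of \<open>w\<close> turns
    \<open>p^(n+1-j) w j\<close> into \<open>\<alpha> p^n w (j-1)\<close>. The step to
    \<open>2n + 2\<close> contributes \<open>1 + \<beta> p^n\<close> in the same way, using
    \<open>\<alpha> \<beta> = p\<close>.\<close>
  have V: "V = (1 + \<alpha> * p ^ n) * W"
  proof -
    have "V = infsum (\<lambda>j. gbin p (2 * n) (int n + j) * w j
            + gbin p (2 * n) (int n - 1 + j) * (p powi (int n + 1 - j) * w j)) UNIV"
      unfolding V_def using gbin_pascal'[OF p(2), of "2 * n"]
      by (intro infsum_cong) (simp add: algebra_simps)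
    also have "\<dots> = W + infsum (\<lambda>j. gbin p (2 * n) (int n - 1 + j) * (p powi (int n + 1 - j) * w j)) UNIV"
      unfolding W_def by (intro infsum_add sm)
    also have "infsum (\<lambda>j. gbin p (2 * n) (int n - 1 + j) * (p powi (int n + 1 - j) * w j)) UNIV
      = infsum (\<lambda>j. \<alpha> * p ^ n * (gbin p (2 * n) (int n + j) * w j)) UNIV"
    proof (rule infsum_reindex_bij_witness[of _ "\<lambda>j. j + 1" "\<lambda>j. j - 1"])
      fix a :: int
      have "p powi (int n + 1 - a) * p powi (a - 1) = p ^ n"
        using p by (simp flip: power_int_add)
      moreover have "w a = w (a - 1) * p powi (a - 1) * \<alpha>" using step[of "a - 1"] by simp
      ultimately show "\<alpha> * p ^ n * (gbin p (2 * n) (int n + (a - 1)) * w (a - 1))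
        = gbin p (2 * n) (int n - 1 + a) * (p powi (int n + 1 - a) * w a)"
        by (simp add: algebra_simps)
    qed auto
    also have "\<dots> = \<alpha> * p ^ n * W"
      unfolding W_def by (rule infsum_cmult_right')
    finally show ?thesis by (simp add: algebra_simps)
  qed
  have "infsum (\<lambda>j. gbin p (2 * Suc n) (int (Suc n) + j) * w j) UNIV
      = infsum (\<lambda>j. gbin p (2 * n + 1) (int n + j) * w j
            + gbin p (2 * n + 1) (int n + 1 + j) * (p powi (int n + 1 + j) * w j)) UNIV"
    using gbin_pascal[OF p(2), of "2 * n + 1"]
    by (intro infsum_cong) (simp add: algebra_simps)
  also have "\<dots> = V + infsum (\<lambda>j. gbin p (2 * n + 1) (int n + 1 + j) * (p powi (int n + 1 + j) * w j)) UNIV"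
    unfolding V_def by (intro infsum_add sm)
  also have "infsum (\<lambda>j. gbin p (2 * n + 1) (int n + 1 + j) * (p powi (int n + 1 + j) * w j)) UNIV
      = infsum (\<lambda>j. \<beta> * p ^ n * (gbin p (2 * n + 1) (int n + j) * w j)) UNIV"
  proof (rule infsum_reindex_bij_witness[of _ "\<lambda>j. j - 1" "\<lambda>j. j + 1"])
    fix a :: int
    have "p powi (int n + 1 + a) = p powi (int n + a) * p"
      using p power_int_add[of p "int n + a" 1] by (simp add: algebra_simps)
    also have "\<dots> = p ^ n * p powi a * (\<alpha> * \<beta>)"
      using p ab by (simp add: power_int_add)
    finally have "p powi (int n + 1 + a) = p ^ n * p powi a * (\<alpha> * \<beta>)" .
    then show "\<beta> * p ^ n * (gbin p (2 * n + 1) (int n + (a + 1)) * w (a + 1))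
        = gbin p (2 * n + 1) (int n + 1 + a) * (p powi (int n + 1 + a) * w a)"
      unfolding step by (simp add: ac_simps)
  qed auto
  also have "\<dots> = \<beta> * p ^ n * V"
    unfolding V_def by (rule infsum_cmult_right')
  finally show ?case
    using Suc.IH by (simp add: V W_def qpoch_def algebra_simps)
qed

text \<open>Limit of the finite form: the centred Gaussian coefficients tend to
  \<open>1 / qpoch_inf p p\<close> and are uniformly bounded, so dominated convergence
  applies.\<close>

lemma jacobi_triple_product:
  fixes w :: "int \<Rightarrow> complex"
  assumes p: "p \<noteq> 0" "norm p < 1" and ab: "\<alpha> * \<beta> = p"
    and w0: "w 0 = 1" and step: "\<And>j. w (j + 1) = w j * p powi j * \<alpha>"
    and w: "w summable_on UNIV"
  shows "infsum w UNIV = qpoch_inf (- \<alpha>) p * qpoch_inf (- \<beta>) p * qpoch_inf p p"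
proof -
  obtain C where C: "C \<ge> 0" "\<And>n k. norm (gbin p n k) \<le> C" using gbin_bounded[OF p(2)] by blast
  have "(\<lambda>n. infsum (\<lambda>j. gbin p (2 * n) (int n + j) * w j) UNIV)
      \<longlonglongrightarrow> infsum (\<lambda>j. 1 / qpoch_inf p p * w j) UNIV"
  proof (rule infsum_tendsto_dominated)
    show "(\<lambda>n. gbin p (2 * n) (int n + j) * w j) \<longlonglongrightarrow> 1 / qpoch_inf p p * w j" for j
      using gbin_tendsto_central[OF p(2), of 0 j] by (intro tendsto_intros) auto
    show "\<forall>\<^sub>F n in sequentially. \<forall>j. norm (gbin p (2 * n) (int n + j) * w j) \<le> C * norm (w j)"
      using C by (auto simp: norm_mult intro!: always_eventually mult_right_mono)
    show "(\<lambda>j. C * norm (w j)) summable_on UNIV"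
      using w by (intro summable_on_cmult_right) (simp add: summable_on_iff_abs_summable_on_complex)
  qed
  moreover have "(\<lambda>n. infsum (\<lambda>j. gbin p (2 * n) (int n + j) * w j) UNIV)
      \<longlonglongrightarrow> qpoch_inf (- \<alpha>) p * qpoch_inf (- \<beta>) p"
    unfolding jacobi_triple_product_finite[OF p ab w0 step] by (intro tendsto_intros qpoch_tendsto p)
  ultimately have "infsum (\<lambda>j. 1 / qpoch_inf p p * w j) UNIV = qpoch_inf (- \<alpha>) p * qpoch_inf (- \<beta>) p"
    using LIMSEQ_unique by blast
  then show ?thesis
    using qpoch_inf_nonzero[OF p(2) p(2)] by (simp only: infsum_cmult_right') (simp add: field_simps)
qed

lemma minus_one_powi_add_one: "(-1 :: complex) powi (k + 1) = - ((-1) powi k)"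
  by (simp add: power_int_add)

lemma sign_powi_minus: "e = 1 \<or> e = (-1 :: complex) \<Longrightarrow> e powi (- k) = e powi k"
  by (auto simp: power_int_minus power_int_minus_left)

text \<open>For \<open>e\<close> equal to 1 or -1 this is Ramanujan's
  \<open>f(e t^(a+b), e t^(a-b))\<close>. The exponent has no division by 2, so a theta function
  with half-integral exponents in \<open>q\<close> is written with \<open>t^2 = q\<close>.\<close>

definition qtheta :: "complex \<Rightarrow> int \<Rightarrow> int \<Rightarrow> complex \<Rightarrow> complex" where
  "qtheta e a b t = infsum (\<lambda>n. e powi n * t powi (a * n\<^sup>2 + b * n)) UNIV"

lemma qtheta_exponent_bound:
  fixes a b n :: int
  assumes "1 \<le> a"
  shows "\<bar>n\<bar> \<le> a * n\<^sup>2 + b * n + (\<bar>b\<bar> + 1)\<^sup>2"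
proof -
  define B where "B = \<bar>b\<bar> + 1"
  have "0 \<le> (\<bar>n\<bar> - B)\<^sup>2 + \<bar>n\<bar> * B" unfolding B_def by (intro add_nonneg_nonneg mult_nonneg_nonneg) auto
  then have "B * \<bar>n\<bar> \<le> n\<^sup>2 + B\<^sup>2" by (simp add: power2_diff algebra_simps)
  moreover have "1 * n\<^sup>2 \<le> a * n\<^sup>2" using assms by (intro mult_right_mono) auto
  moreover have "- (b * n) \<le> \<bar>b\<bar> * \<bar>n\<bar>" by (metis abs_ge_minus_self abs_mult)
  moreover have "B * \<bar>n\<bar> = \<bar>b\<bar> * \<bar>n\<bar> + \<bar>n\<bar>" by (simp add: B_def algebra_simps)
  ultimately have "\<bar>n\<bar> \<le> a * n\<^sup>2 + b * n + B\<^sup>2" by linarith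
  then show ?thesis by (simp only: B_def)
qed

lemma norm_sign_powi_le: "e = 1 \<or> e = (-1 :: complex) \<Longrightarrow> norm (e powi k) \<le> 1"
  by (auto simp: norm_power_int)

lemma summable_on_qtheta:
  fixes e t :: complex
  assumes t: "t \<noteq> 0" "norm t < 1" and e: "e = 1 \<or> e = -1" and a: "1 \<le> a"
  shows "(\<lambda>n. e powi n * t powi (a * n\<^sup>2 + b * n)) summable_on UNIV"
  using qtheta_exponent_bound[OF a, of _ b] norm_sign_powi_le[OF e]
  by (intro summable_on_powi_int[where K = 1 and C = "nat ((\<bar>b\<bar> + 1)\<^sup>2)" and c = "\<lambda>n. e powi n"] t) simp_all

lemma qtheta_product:
  assumes t: "t \<noteq> 0" "norm t < 1" and e: "e = 1 \<or> e = -1" and a: "1 \<le> a"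
  shows "qtheta e a b t = qpoch_inf (- (e * t powi (a + b))) (t powi (2 * a)) *
     qpoch_inf (- (e * t powi (a - b))) (t powi (2 * a)) * qpoch_inf (t powi (2 * a)) (t powi (2 * a))"
  unfolding qtheta_def
proof (rule jacobi_triple_product)
  show "t powi (2 * a) \<noteq> 0" using t by simp
  have "t powi (2 * a) = (t ^ nat (2 * a))" using a by (simp add: power_int_nonneg_exp)
  then show "norm (t powi (2 * a)) < 1"
    using t a by (simp add: norm_power power_less_one_iff)
  show "e * t powi (a + b) * (e * t powi (a - b)) = t powi (2 * a)"
    using e t by (auto simp flip: power_int_add)
  show "e powi (j + 1) * t powi (a * (j + 1)\<^sup>2 + b * (j + 1))
     = e powi j * t powi (a * j\<^sup>2 + b * j) * (t powi (2 * a)) powi j * (e * t powi (a + b))" for j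
  proof -
    have "a * (j + 1)\<^sup>2 + b * (j + 1) = (a * j\<^sup>2 + b * j) + (2 * a) * j + (a + b)"
      by (simp add: power2_eq_square algebra_simps)
    moreover have "e \<noteq> 0" using e by auto
    ultimately show ?thesis
      using t by (simp add: power_int_add power_int_mult)
  qed
qed (use summable_on_qtheta[OF assms] in auto)

subsection \<open>The Rogers-Ramanujan identities\<close>

text \<open>Both sides of the finite forms satisfy the recurrences
  \<open>S\<^sub>n\<^sub>+\<^sub>1 = S\<^sub>n + q\<^bsup>n+1\<^esup> T\<^sub>n\<close> and \<open>T\<^sub>n\<^sub>+\<^sub>1 = q\<^bsup>n+1\<^esup> S\<^sub>n\<^sub>+\<^sub>1 + (1 - q\<^bsup>n+1\<^esup>) T\<^sub>n\<close>.\<close>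

definition rr_sum :: "int \<Rightarrow> complex \<Rightarrow> nat \<Rightarrow> complex" where
  "rr_sum a q n = infsum (\<lambda>j. gbin q n j * q powi (j\<^sup>2 + a * j)) UNIV"

text \<open>The alternating side of Bressoud's polynomial forms of the Rogers-Ramanujan identities,
  where \<open>[2n, n+2r]\<close> carries \<open>(-1)^r q^(r(5r+1)/2)\<close> and
  \<open>[2n+1, n+2r]\<close> carries \<open>(-1)^r q^(r(5r-3)/2)\<close>; here
  \<open>q = t^2\<close>.\<close>

definition rr_alt :: "nat \<Rightarrow> int \<Rightarrow> complex \<Rightarrow> nat \<Rightarrow> complex" where
  "rr_alt c b t n = infsum (\<lambda>r. gbin (t\<^sup>2) (2 * n + c) (int n + 2 * r) * ((-1) powi r * t powi (5 * r\<^sup>2 + b * r))) UNIV"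

lemma summable_on_gbin0: "(\<lambda>r. gbin q n r * g r) summable_on UNIV"
  using summable_on_gbin1[of q n 0 g] by simp

lemma infsum_add3:
  fixes f g h :: "'a \<Rightarrow> complex"
  assumes "f summable_on A" "g summable_on A" "h summable_on A"
  shows "infsum (\<lambda>x. f x + (g x + h x)) A = infsum f A + (infsum g A + infsum h A)"
  using assms by (simp add: infsum_add summable_on_add)

lemma rr_sum_Suc:
  assumes q: "q \<noteq> 0" "norm q < 1"
  shows "rr_sum 0 q (Suc n) = rr_sum 0 q n + q ^ Suc n * rr_sum 1 q n"
    and "rr_sum 1 q (Suc n) = q ^ Suc n * rr_sum 0 q (Suc n) + (1 - q ^ Suc n) * rr_sum 1 q n"
proof -
  note sm = summable_on_gbin0 summable_on_gbin1
  have "rr_sum 0 q (Suc n) = infsum (\<lambda>j. gbin q n j * q powi j\<^sup>2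
      + gbin q n (-1 + j) * (q powi (int n + 1 - j) * q powi j\<^sup>2)) UNIV"
    unfolding rr_sum_def gbin_pascal'[OF q(2)] by (intro infsum_cong) (simp add: algebra_simps)
  also have "\<dots> = rr_sum 0 q n + infsum (\<lambda>j. gbin q n (-1 + j) * (q powi (int n + 1 - j) * q powi j\<^sup>2)) UNIV"
    unfolding rr_sum_def mult_zero_left add_0_right by (intro infsum_add sm)
  also have "infsum (\<lambda>j. gbin q n (-1 + j) * (q powi (int n + 1 - j) * q powi j\<^sup>2)) UNIV
      = infsum (\<lambda>j. q ^ Suc n * (gbin q n j * q powi (j\<^sup>2 + 1 * j))) UNIV"
  proof (rule infsum_reindex_bij_witness[of _ "\<lambda>j. j + 1" "\<lambda>j. j - 1"])
    fix j :: int
    have "int n + 1 - j + j\<^sup>2 = int (Suc n) + ((j - 1)\<^sup>2 + 1 * (j - 1))"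
      by (simp add: power2_eq_square algebra_simps)
    then have "q powi (int n + 1 - j) * q powi j\<^sup>2 = q powi int (Suc n) * q powi ((j - 1)\<^sup>2 + 1 * (j - 1))"
      using q by (simp only: power_int_add[symmetric] simp_thms)
    then have "q powi (int n + 1 - j) * q powi j\<^sup>2 = q ^ Suc n * q powi ((j - 1)\<^sup>2 + 1 * (j - 1))"
      by (simp only: power_int_of_nat)
    then show "q ^ Suc n * (gbin q n (j - 1) * q powi ((j - 1)\<^sup>2 + 1 * (j - 1)))
       = gbin q n (-1 + j) * (q powi (int n + 1 - j) * q powi j\<^sup>2)"
      by simp
  qed auto
  also have "\<dots> = q ^ Suc n * rr_sum 1 q n"
    unfolding rr_sum_def by (rule infsum_cmult_right')
  finally show "rr_sum 0 q (Suc n) = rr_sum 0 q n + q ^ Suc n * rr_sum 1 q n" .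
  \<comment> \<open>This recurrence holds summand by summand: absorption replaces
    \<open>(1 - q^(n+1))\<close> times the old coefficient by \<open>(1 - q^(n+1-j))\<close> times
    the new one, and \<open>q^(n+1-j) q^(j^2+j) = q^(n+1) q^(j^2)\<close>.\<close>
  have "rr_sum 1 q (Suc n) = infsum (\<lambda>j. q ^ Suc n * (gbin q (Suc n) j * q powi (j\<^sup>2 + 0 * j))
      + (1 - q ^ Suc n) * (gbin q n j * q powi (j\<^sup>2 + 1 * j))) UNIV"
    unfolding rr_sum_def
  proof (rule infsum_cong)
    fix j :: int
    have "(int n + 1 - j) + (j\<^sup>2 + 1 * j) = int (Suc n) + (j\<^sup>2 + 0 * j)" by simp
    then have "q powi (int n + 1 - j) * q powi (j\<^sup>2 + 1 * j) = q powi int (Suc n) * q powi (j\<^sup>2 + 0 * j)"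
      using q by (simp only: power_int_add[symmetric] simp_thms)
    then have *: "q powi (int n + 1 - j) * q powi (j\<^sup>2 + 1 * j) = q ^ Suc n * q powi (j\<^sup>2 + 0 * j)"
      by (simp only: power_int_of_nat)
    have "(1 - q ^ Suc n) * (gbin q n j * q powi (j\<^sup>2 + 1 * j))
       = ((1 - q powi (int n + 1 - j)) * gbin q (Suc n) j) * q powi (j\<^sup>2 + 1 * j)"
      unfolding gbin_Suc_absorb[OF q(2)] by (simp only: mult.assoc)
    also have "\<dots> = gbin q (Suc n) j * q powi (j\<^sup>2 + 1 * j)
        - gbin q (Suc n) j * (q powi (int n + 1 - j) * q powi (j\<^sup>2 + 1 * j))"
      by algebra
    finally show "gbin q (Suc n) j * q powi (j\<^sup>2 + 1 * j) = q ^ Suc n * (gbin q (Suc n) j * q powi (j\<^sup>2 + 0 * j))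
      + (1 - q ^ Suc n) * (gbin q n j * q powi (j\<^sup>2 + 1 * j))"
      unfolding * by (simp only: mult.left_commute[of _ "q ^ Suc n"] diff_add_cancel add.commute[of "q ^ Suc n * _"])
  qed
  also have "\<dots> = infsum (\<lambda>j. q ^ Suc n * (gbin q (Suc n) j * q powi (j\<^sup>2 + 0 * j))) UNIV
      + infsum (\<lambda>j. (1 - q ^ Suc n) * (gbin q n j * q powi (j\<^sup>2 + 1 * j))) UNIV"
    by (intro infsum_add summable_on_cmult_right sm)
  also have "infsum (\<lambda>j. q ^ Suc n * (gbin q (Suc n) j * q powi (j\<^sup>2 + 0 * j))) UNIV = q ^ Suc n * rr_sum 0 q (Suc n)"
    unfolding rr_sum_def by (rule infsum_cmult_right')
  also have "infsum (\<lambda>j. (1 - q ^ Suc n) * (gbin q n j * q powi (j\<^sup>2 + 1 * j))) UNIV = (1 - q ^ Suc n) * rr_sum 1 q n"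
    unfolding rr_sum_def by (rule infsum_cmult_right')
  finally show "rr_sum 1 q (Suc n) = q ^ Suc n * rr_sum 0 q (Suc n) + (1 - q ^ Suc n) * rr_sum 1 q n" .
qed

lemma rr_alt_Suc:
  assumes t: "t \<noteq> 0" "norm (t\<^sup>2) < 1"
  shows "rr_alt 0 1 t (Suc n) = rr_alt 0 1 t n + (t\<^sup>2) ^ Suc n * rr_alt 1 (-3) t n"
    and "rr_alt 1 (-3) t (Suc n)
      = (t\<^sup>2) ^ Suc n * rr_alt 0 1 t (Suc n) + (1 - (t\<^sup>2) ^ Suc n) * rr_alt 1 (-3) t n"
proof -
  define q where "q = t\<^sup>2"
  have q: "norm q < 1" using t by (simp add: q_def)
  note sm = summable_on_gbin[of 2, simplified]
  have alg1: "- (g * (y * (- m * T2))) = g * (x * (m * T1))" if "x * T1 = w" "y * T2 = w" for g m x y w T1 T2 :: complex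
  proof -
    have "- (g * (y * (- m * T2))) = g * m * (y * T2)" "g * (x * (m * T1)) = g * m * (x * T1)" by simp_all
    then show ?thesis using that by simp
  qed
  have alg2: "G * (m * T1) = A * (m * T1) + (B * (x * (m * T1)) + Q * (C * (m * T2)))"
    if "y * T1 = Q * T2" "G = A + x * B + y * C" for G A B C Q m x y T1 T2 :: complex
  proof -
    have "G * (m * T1) = A * (m * T1) + B * (x * (m * T1)) + C * m * (y * T1)"
      unfolding that(2) by (simp add: algebra_simps)
    then show ?thesis unfolding that(1) by (simp add: algebra_simps)
  qed
  have alg3: "- Q * (g * (- m * T2)) = g * (x * (m * T1))" if "x * T1 = Q * T2" for g m x Q T1 T2 :: complex
  proof -
    have "g * (x * (m * T1)) = g * m * (x * T1)" by simp
    also have "\<dots> = - Q * (g * (- m * T2))" unfolding that by simp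
    finally show ?thesis by (rule sym)
  qed
  have alg4: "G * (m * T1) = Q * (C * (m * T2)) + (A * (m * T1) + B * (x * (m * T1)))"
    if "y * T1 = Q * T2" "G = A + x * B + y * C" for G A B C Q m x y T1 T2 :: complex
    using alg2[OF that] by simp
  have comb: "t powi x * t powi y = t powi z" if "x + y = z" for x y z
    using that t by (simp flip: power_int_add)
  have qp: "q powi k = t powi (2 * k)" for k
    unfolding q_def by (simp add: power_int_power)
  have qn: "q ^ Suc n = t powi (2 * int n + 2)"
    using qp[of "int (Suc n)"] unfolding power_int_of_nat by (simp add: algebra_simps)
  define u :: "int \<Rightarrow> complex" where "u r = (-1) powi r * t powi (5 * r\<^sup>2 + 1 * r)" for r
  define v :: "int \<Rightarrow> complex" where "v r = (-1) powi r * t powi (5 * r\<^sup>2 + (-3) * r)" for r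
  have s: "rr_alt 0 1 t m = infsum (\<lambda>r. gbin q (2 * m) (int m + 2 * r) * u r) UNIV" for m
    by (simp add: rr_alt_def q_def u_def)
  have ta: "rr_alt 1 (-3) t m = infsum (\<lambda>r. gbin q (2 * m + 1) (int m + 2 * r) * v r) UNIV" for m
    by (simp add: rr_alt_def q_def v_def)
  \<comment> \<open>Under the reflection \<open>r\<close> to \<open>-1 - r\<close> the Gaussian
    coefficient and the total exponent \<open>5r^2 + 5r + 2n + 2\<close> are invariant while the
    sign changes, so the sum equals its own negative.\<close>
  have 1: "infsum (\<lambda>r. gbin q (2 * n) (int n + 1 + 2 * r) * (q powi (int n + 1 + 2 * r) * u r)) UNIV = 0"
    (is "infsum ?f _ = 0")
  proof -
    have "infsum ?f UNIV = infsum (\<lambda>r. - ?f r) UNIV"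
    proof (rule infsum_reindex_bij_witness[of _ "\<lambda>r. - 1 - r" "\<lambda>r. - 1 - r"])
      fix r :: int
      have g: "gbin q (2 * n) (int n + 1 + 2 * (- 1 - r)) = gbin q (2 * n) (int n + 1 + 2 * r)"
        using gbin_symmetric[of q "2 * n" "int n + 1 + 2 * r"] by (simp add: algebra_simps)
      have m: "(-1 :: complex) powi (- 1 - r) = - ((-1) powi r)"
        using minus_one_powi_add_one[of "- 1 - r"] sign_powi_minus[of "-1" r] by simp
      have a: "q powi (int n + 1 + 2 * r) * t powi (5 * r\<^sup>2 + 1 * r) = t powi (5 * r\<^sup>2 + 5 * r + 2 * int n + 2)"
        unfolding qp by (rule comb) (simp add: power2_eq_square algebra_simps)
      have b: "q powi (int n + 1 + 2 * (- 1 - r)) * t powi (5 * (- 1 - r)\<^sup>2 + 1 * (- 1 - r)) = t powi (5 * r\<^sup>2 + 5 * r + 2 * int n + 2)"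
        unfolding qp by (rule comb) (simp add: power2_eq_square algebra_simps)
      show "- ?f (- 1 - r) = ?f r"
        unfolding g u_def m by (rule alg1[OF a b])
    qed auto
    then show ?thesis by (simp add: infsum_uminus)
  qed
  \<comment> \<open>Both forms of Pascal's rule are applied, one for each unit in
    \<open>2n + 2\<close>. The three resulting sums are the old value, the antisymmetric sum that
    vanishes, and the coupling to the companion sequence.\<close>
  have "rr_alt 0 1 t (Suc n) = infsum (\<lambda>r. gbin q (2 * n) (int n + 2 * r) * u r
      + (gbin q (2 * n) (int n + 1 + 2 * r) * (q powi (int n + 1 + 2 * r) * u r)
      + q ^ Suc n * (gbin q (2 * n + 1) (int n + 2 * r) * v r))) UNIV"
    unfolding s
  proof (rule infsum_cong)
    fix r :: int
    have a: "q powi (int n + 1 - 2 * r) * t powi (5 * r\<^sup>2 + 1 * r) = q ^ Suc n * t powi (5 * r\<^sup>2 + (-3) * r)"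
      unfolding qp qn by (subst (1 2) comb[OF refl]) (simp add: algebra_simps)
    have "gbin q (2 * Suc n) (int (Suc n) + 2 * r) = gbin q (2 * n + 1) (int n + 1 + 2 * r)
       + q powi (int n + 1 - 2 * r) * gbin q (2 * n + 1) (int n + 2 * r)"
      using gbin_pascal'[OF q, of "2 * n + 1" "int n + 1 + 2 * r"] by (simp add: algebra_simps)
    also have "gbin q (2 * n + 1) (int n + 1 + 2 * r) = gbin q (2 * n) (int n + 2 * r)
       + q powi (int n + 1 + 2 * r) * gbin q (2 * n) (int n + 1 + 2 * r)"
      using gbin_pascal[OF q, of "2 * n" "int n + 1 + 2 * r"] by (simp add: algebra_simps)
    finally show "gbin q (2 * Suc n) (int (Suc n) + 2 * r) * u r = gbin q (2 * n) (int n + 2 * r) * u r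
      + (gbin q (2 * n) (int n + 1 + 2 * r) * (q powi (int n + 1 + 2 * r) * u r)
      + q ^ Suc n * (gbin q (2 * n + 1) (int n + 2 * r) * v r))"
      unfolding v_def u_def by (rule alg2[OF a])
  qed
  also have "\<dots> = rr_alt 0 1 t n + (0 + q ^ Suc n * rr_alt 1 (-3) t n)"
    by (subst infsum_add3) (intro sm summable_on_cmult_right | simp only: s ta 1 infsum_cmult_right')+
  finally show "rr_alt 0 1 t (Suc n) = rr_alt 0 1 t n + (t\<^sup>2) ^ Suc n * rr_alt 1 (-3) t n"
    by (simp add: q_def)
  \<comment> \<open>The reflection \<open>r\<close> to \<open>1 - r\<close> fixes the coefficient up
    to symmetry and flips the sign; it identifies the extra sum with \<open>- q^(n+1)\<close> times
    the companion sequence.\<close>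
  have 2: "infsum (\<lambda>r. gbin q (2 * n + 1) (int n - 1 + 2 * r) * (q powi (int n + 2 - 2 * r) * v r)) UNIV
     = infsum (\<lambda>r. - (q ^ Suc n) * (gbin q (2 * n + 1) (int n + 2 * r) * v r)) UNIV"
  proof (rule infsum_reindex_bij_witness[of _ "\<lambda>r. 1 - r" "\<lambda>r. 1 - r"])
    fix r :: int
    have g: "gbin q (2 * n + 1) (int n + 2 * (1 - r)) = gbin q (2 * n + 1) (int n - 1 + 2 * r)"
      using gbin_symmetric[of q "2 * n + 1" "int n - 1 + 2 * r"] by (simp add: algebra_simps)
    have m: "(-1 :: complex) powi (1 - r) = - ((-1) powi r)"
      using minus_one_powi_add_one[of "- r"] sign_powi_minus[of "-1" r] by simp
    have a: "q powi (int n + 2 - 2 * r) * t powi (5 * r\<^sup>2 + (-3) * r) = q ^ Suc n * t powi (5 * (1 - r)\<^sup>2 + (-3) * (1 - r))"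
      unfolding qp qn by (subst (1 2) comb[OF refl]) (simp add: power2_eq_square algebra_simps)
    show "- (q ^ Suc n) * (gbin q (2 * n + 1) (int n + 2 * (1 - r)) * v (1 - r))
      = gbin q (2 * n + 1) (int n - 1 + 2 * r) * (q powi (int n + 2 - 2 * r) * v r)"
      unfolding g v_def m by (rule alg3[OF a])
  qed auto
  \<comment> \<open>Pascal's rule first splits off the new even-index sum, already available at
    \<open>n + 1\<close>; its second form then brings the remainder down to
    \<open>2n + 1\<close>.\<close>
  have "rr_alt 1 (-3) t (Suc n) = infsum (\<lambda>r. q ^ Suc n * (gbin q (2 * Suc n) (int (Suc n) + 2 * r) * u r)
      + (gbin q (2 * n + 1) (int n + 2 * r) * v r
      + gbin q (2 * n + 1) (int n - 1 + 2 * r) * (q powi (int n + 2 - 2 * r) * v r))) UNIV"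
    unfolding ta
  proof (rule infsum_cong)
    fix r :: int
    have a: "q powi (int n + 1 + 2 * r) * t powi (5 * r\<^sup>2 + (-3) * r) = q ^ Suc n * t powi (5 * r\<^sup>2 + 1 * r)"
      unfolding qp qn by (subst (1 2) comb[OF refl]) (simp add: algebra_simps)
    have "gbin q (2 * Suc n + 1) (int (Suc n) + 2 * r) = gbin q (2 * n + 2) (int n + 2 * r)
       + q powi (int n + 1 + 2 * r) * gbin q (2 * Suc n) (int (Suc n) + 2 * r)"
      using gbin_pascal[OF q, of "2 * n + 2" "int n + 1 + 2 * r"] by (simp add: algebra_simps)
    also have "gbin q (2 * n + 2) (int n + 2 * r) = gbin q (2 * n + 1) (int n + 2 * r)
       + q powi (int n + 2 - 2 * r) * gbin q (2 * n + 1) (int n - 1 + 2 * r)"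
      using gbin_pascal'[OF q, of "2 * n + 1" "int n + 2 * r"] by (simp add: algebra_simps)
    finally show "gbin q (2 * Suc n + 1) (int (Suc n) + 2 * r) * v r = q ^ Suc n * (gbin q (2 * Suc n) (int (Suc n) + 2 * r) * u r)
      + (gbin q (2 * n + 1) (int n + 2 * r) * v r
      + gbin q (2 * n + 1) (int n - 1 + 2 * r) * (q powi (int n + 2 - 2 * r) * v r))"
      unfolding v_def u_def by (rule alg4[OF a])
  qed
  also have "\<dots> = q ^ Suc n * rr_alt 0 1 t (Suc n) + (rr_alt 1 (-3) t n + (- (q ^ Suc n) * rr_alt 1 (-3) t n))"
    by (subst infsum_add3) (intro sm summable_on_cmult_right | simp only: s ta 2 infsum_cmult_right')+
  finally show "rr_alt 1 (-3) t (Suc n)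
      = (t\<^sup>2) ^ Suc n * rr_alt 0 1 t (Suc n) + (1 - (t\<^sup>2) ^ Suc n) * rr_alt 1 (-3) t n"
    by (simp add: q_def algebra_simps)
qed

lemma rogers_ramanujan_finite:
  assumes t: "t \<noteq> 0" "norm (t\<^sup>2) < 1"
  shows "rr_sum 0 (t\<^sup>2) n = rr_alt 0 1 t n \<and> rr_sum 1 (t\<^sup>2) n = rr_alt 1 (-3) t n"
proof (induction n)
  case 0
  have 1: "rr_sum a (t\<^sup>2) 0 = 1" for a
  proof -
    have "rr_sum a (t\<^sup>2) 0 = infsum (\<lambda>j. gbin (t\<^sup>2) 0 j * (t\<^sup>2) powi (j\<^sup>2 + a * j)) {0}"
      unfolding rr_sum_def by (rule infsum_cong_neutral) (auto simp: gbin_0)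
    then show ?thesis by (simp add: gbin_0)
  qed
  \<comment> \<open>For \<open>c\<close> at most 1 only \<open>r = 0\<close> puts
    \<open>2 * r\<close> into the range \<open>0..c\<close>.\<close>
  have 2: "rr_alt c b t 0 = 1" if "c \<le> 1" for b c
  proof -
    have "rr_alt c b t 0 = infsum (\<lambda>r. gbin (t\<^sup>2) c (2 * r) * ((-1) powi r * t powi (5 * r\<^sup>2 + b * r))) {0}"
      unfolding rr_alt_def using that by (intro infsum_cong_neutral) (auto simp: gbin_def)
    then show ?thesis using qpoch_nonzero[OF t(2) t(2)] by (simp add: gbin_def)
  qed
  show ?case using 1 2 by simp
next
  case (Suc n)
  have "t\<^sup>2 \<noteq> 0" using t by simp
  from rr_sum_Suc[OF this t(2), of n] rr_alt_Suc[OF t, of n] Suc show ?case by simp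
qed

section \<open>Limits of the finite Rogers-Ramanujan identities\<close>

lemma rr_sum_tendsto:
  fixes a :: nat
  assumes q: "q \<noteq> 0" "norm q < 1" and a: "a \<le> 1"
  shows "rr_sum (int a) q \<longlonglongrightarrow> (\<Sum>n. q ^ (n\<^sup>2 + a * n) / qpoch q q n)"
proof -
  obtain C where C: "C \<ge> 0" "\<And>n k. norm (gbin q n k) \<le> C" using gbin_bounded[OF q(2)] by blast
  \<comment> \<open>The limiting summand, extended by zero to negative indices to match the sum over
    all integers.\<close>
  define g where "g j = (if j \<ge> 0 then 1 / qpoch q q (nat j) else 0) * q powi (j\<^sup>2 + int a * j)" for j
  have "(\<lambda>j. 1 powi j * q powi (1 * j\<^sup>2 + int a * j)) summable_on UNIV"
    by (rule summable_on_qtheta) (use q a in auto)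
  then have smn: "(\<lambda>j. norm (q powi (j\<^sup>2 + int a * j))) summable_on UNIV"
    by (simp add: summable_on_iff_abs_summable_on_complex)
  have lim: "(\<lambda>n. gbin q n j) \<longlonglongrightarrow> (if j \<ge> 0 then 1 / qpoch q q (nat j) else 0)" for j
  proof (cases "j \<ge> 0")
    case True
    then show ?thesis using gbin_tendsto[OF q(2), of "nat j"] by simp
  qed (simp add: gbin_def)
  have bound: "norm (gbin q n j * q powi (j\<^sup>2 + int a * j)) \<le> C * norm (q powi (j\<^sup>2 + int a * j))" for n j
    unfolding norm_mult using C by (intro mult_right_mono) auto
  have Csm: "(\<lambda>j. C * norm (q powi (j\<^sup>2 + int a * j))) summable_on UNIV"
    using smn by (intro summable_on_cmult_right)
  have "rr_sum (int a) q \<longlonglongrightarrow> infsum g UNIV"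
    unfolding rr_sum_def g_def using lim bound Csm
    by (intro infsum_tendsto_dominated[where M = "\<lambda>j. C * norm (q powi (j\<^sup>2 + int a * j))"] tendsto_intros) auto
  moreover have "infsum g UNIV = (\<Sum>n. q ^ (n\<^sup>2 + a * n) / qpoch q q n)"
  proof -
    have gb: "norm (g j) \<le> C * norm (q powi (j\<^sup>2 + int a * j))" for j
      unfolding g_def
      by (rule tendsto_upperbound[OF tendsto_norm[OF tendsto_mult_right[OF lim[of j]]]])
         (use bound in auto)
    have sg: "g summable_on UNIV"
      using Infinite_Sum.abs_summable_on_comparison_test'[OF Csm, of g] gb
      by (simp add: summable_on_iff_abs_summable_on_complex)
    have gi: "g (int n) = q ^ (n\<^sup>2 + a * n) / qpoch q q n" for n
    proof -
      have "int n ^ 2 + int a * int n = int (n\<^sup>2 + a * n)" by simp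
      then have "q powi (int n ^ 2 + int a * int n) = q ^ (n\<^sup>2 + a * n)" by (simp only: power_int_of_nat)
      then show ?thesis by (simp add: g_def)
    qed
    have eq: "infsum g UNIV = infsum g (range int)"
    proof (rule infsum_cong_neutral)
      fix x :: int assume "x \<in> UNIV - range int"
      then have "x < 0" by (metis DiffE linorder_not_less nonneg_int_cases rangeI)
      then show "g x = 0" by (simp add: g_def)
    qed auto
    have "(g has_sum infsum g UNIV) (range int)"
      unfolding eq using sg summable_on_subset_banach by (intro has_sum_infsum) blast
    then have "((\<lambda>n. g (int n)) has_sum infsum g UNIV) UNIV"
      by (subst (asm) has_sum_reindex) (auto simp: o_def)
    then show ?thesis unfolding gi using has_sum_imp_sums sums_unique by blast
  qed
  ultimately show ?thesis by simp
qed

text \<open>The central Gaussian coefficients have the same limit for every \<open>c\<close> and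
  every offset, so one common factor and a theta series remain.\<close>

lemma rr_alt_tendsto:
  assumes t: "t \<noteq> 0" "norm t < 1"
  shows "rr_alt c b t \<longlonglongrightarrow> qtheta (-1) 5 b t / euler_E (t\<^sup>2)"
proof -
  have t2: "norm (t\<^sup>2) < 1" using t by (simp add: norm_power power_less_one_iff)
  obtain C where C: "C \<ge> 0" "\<And>n k. norm (gbin (t\<^sup>2) n k) \<le> C" using gbin_bounded[OF t2] by blast
  define w :: "int \<Rightarrow> complex" where "w r = (-1) powi r * t powi (5 * r\<^sup>2 + b * r)" for r
  have w: "w summable_on UNIV" unfolding w_def by (rule summable_on_qtheta) (use t in auto)
  have "rr_alt c b t \<longlonglongrightarrow> infsum (\<lambda>r. 1 / qpoch_inf (t\<^sup>2) (t\<^sup>2) * w r) UNIV"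
    unfolding rr_alt_def w_def[symmetric]
  proof (rule infsum_tendsto_dominated)
    show "(\<lambda>n. gbin (t\<^sup>2) (2 * n + c) (int n + 2 * r) * w r) \<longlonglongrightarrow> 1 / qpoch_inf (t\<^sup>2) (t\<^sup>2) * w r" for r
      using gbin_tendsto_central[OF t2, of c "2 * r"] by (intro tendsto_intros) auto
    show "\<forall>\<^sub>F n in sequentially. \<forall>r. norm (gbin (t\<^sup>2) (2 * n + c) (int n + 2 * r) * w r) \<le> C * norm (w r)"
      using C by (auto simp: norm_mult intro!: always_eventually mult_right_mono)
    show "(\<lambda>r. C * norm (w r)) summable_on UNIV"
      using w by (intro summable_on_cmult_right) (simp add: summable_on_iff_abs_summable_on_complex)
  qed
  also have "infsum (\<lambda>r. 1 / qpoch_inf (t\<^sup>2) (t\<^sup>2) * w r) UNIV = qtheta (-1) 5 b t / euler_E (t\<^sup>2)"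
    unfolding infsum_cmult_right' by (simp add: qtheta_def w_def[abs_def] euler_E_def)
  finally show ?thesis .
qed

lemma qtheta_minus:
  assumes e: "e = 1 \<or> e = -1"
  shows "qtheta e a (- b) t = qtheta e a b t"
  unfolding qtheta_def
  by (rule infsum_reindex_bij_witness[of _ uminus uminus]) (auto simp: sign_powi_minus[OF e])

lemma euler_E_nonzero: "norm q < 1 \<Longrightarrow> euler_E q \<noteq> 0"
  by (simp add: euler_E_def qpoch_inf_nonzero)

theorem rogers_ramanujan:
  assumes t: "t \<noteq> 0" "norm t < 1"
  shows "euler_E (t\<^sup>2) * rr_G (t\<^sup>2) = qtheta (-1) 5 1 t"
    and "euler_E (t\<^sup>2) * rr_H (t\<^sup>2) = qtheta (-1) 5 3 t"
proof -
  have t2: "t\<^sup>2 \<noteq> 0" "norm (t\<^sup>2) < 1" using t by (auto simp: norm_power power_less_one_iff)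
  note nz = euler_E_nonzero[OF t2(2)]
  have "rr_sum 0 (t\<^sup>2) \<longlonglongrightarrow> rr_G (t\<^sup>2)"
    using rr_sum_tendsto[OF t2, of 0] by (simp add: rr_G_def)
  moreover have "rr_sum 0 (t\<^sup>2) = rr_alt 0 1 t" using rogers_ramanujan_finite[OF t(1) t2(2)] by blast
  ultimately have "rr_G (t\<^sup>2) = qtheta (-1) 5 1 t / euler_E (t\<^sup>2)"
    using LIMSEQ_unique[OF _ rr_alt_tendsto[OF t, of 0 1]] by simp
  then show "euler_E (t\<^sup>2) * rr_G (t\<^sup>2) = qtheta (-1) 5 1 t" using nz by simp
  have "rr_sum 1 (t\<^sup>2) \<longlonglongrightarrow> rr_H (t\<^sup>2)"
    using rr_sum_tendsto[OF t2, of 1] by (simp add: rr_H_def power2_eq_square add.commute)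
  moreover have "rr_sum 1 (t\<^sup>2) = rr_alt 1 (-3) t" using rogers_ramanujan_finite[OF t(1) t2(2)] by blast
  ultimately have "rr_H (t\<^sup>2) = qtheta (-1) 5 (-3) t / euler_E (t\<^sup>2)"
    using LIMSEQ_unique[OF _ rr_alt_tendsto[OF t, of 1 "-3"]] by simp
  then show "euler_E (t\<^sup>2) * rr_H (t\<^sup>2) = qtheta (-1) 5 3 t" using nz qtheta_minus[of "-1" 5 3 t] by simp
qed

subsection \<open>Product formulas\<close>

lemma qpoch_inf_double:
  assumes "norm q < 1"
  shows "qpoch_inf a q = qpoch_inf a (q\<^sup>2) * qpoch_inf (a * q) (q\<^sup>2)"
  using qpoch_inf_multisection[OF assms, of 2 a] by (simp add: numeral_2_eq_2)

lemma norm_power_less_one: "norm (q::complex) < 1 \<Longrightarrow> 0 < n \<Longrightarrow> norm (q ^ n) < 1"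
  by (simp add: norm_power power_less_one_iff)

lemma qpoch_inf_power_double:
  assumes "norm q < 1" "0 < m"
  shows "qpoch_inf (q ^ a) (q ^ m) = qpoch_inf (q ^ a) (q ^ (2 * m)) * qpoch_inf (q ^ (a + m)) (q ^ (2 * m))"
  using qpoch_inf_double[OF norm_power_less_one[OF assms], of "q ^ a"]
  by (simp add: power_mult[symmetric] power_add mult.commute)

lemma qpoch_inf_power_square:
  assumes "norm q < 1" "0 < m"
  shows "qpoch_inf (q ^ (2 * a)) (q ^ (2 * m)) = qpoch_inf (q ^ a) (q ^ m) * qpoch_inf (- (q ^ a)) (q ^ m)"
  using qpoch_inf_square[OF norm_power_less_one[OF assms], of "q ^ a"]
  by (simp add: power_mult[symmetric] mult.commute)

lemma qpoch_inf_power_nonzero: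
  assumes "norm q < 1" "0 < m" "0 < a"
  shows "qpoch_inf (q ^ a) (q ^ m) \<noteq> 0" "qpoch_inf (- (q ^ a)) (q ^ m) \<noteq> 0"
  using qpoch_inf_nonzero[OF norm_power_less_one norm_power_less_one, of q m q a]
    qpoch_inf_nonzero[of "q ^ m" "- (q ^ a)"] norm_power_less_one[of q m] norm_power_less_one[of q a] assms
  by simp_all

lemma euler_E_multisection5:
  assumes "norm q < 1"
  shows "euler_E q = qpoch_inf q (q ^ 5) * qpoch_inf (q ^ 2) (q ^ 5) * qpoch_inf (q ^ 3) (q ^ 5)
     * qpoch_inf (q ^ 4) (q ^ 5) * qpoch_inf (q ^ 5) (q ^ 5)"
proof -
  have "{..<5::nat} = {0, 1, 2, 3, 4}" by auto
  moreover have "q * q ^ 2 = q ^ 3" "q * q ^ 3 = q ^ 4" "q * q ^ 4 = q ^ 5" "q * q = q ^ 2"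
    by (simp_all add: eval_nat_numeral)
  ultimately show ?thesis
    unfolding euler_E_def by (subst qpoch_inf_multisection[OF assms, of 5]) (simp_all add: mult.assoc)
qed

lemma qtheta_neg_one_5_product:
  assumes q: "t\<^sup>2 = q" "q \<noteq> 0" "norm q < 1"
  shows "qtheta (-1) 5 1 t = qpoch_inf (q ^ 3) (q ^ 5) * qpoch_inf (q ^ 2) (q ^ 5) * qpoch_inf (q ^ 5) (q ^ 5)"
    and "qtheta (-1) 5 3 t = qpoch_inf (q ^ 4) (q ^ 5) * qpoch_inf q (q ^ 5) * qpoch_inf (q ^ 5) (q ^ 5)"
proof -
  have t: "t \<noteq> 0" "norm t < 1"
    using q by (auto simp: norm_power power_less_one_iff)
  have "t ^ 6 = q ^ 3" "t ^ 4 = q ^ 2" "t ^ 10 = q ^ 5" "t ^ 8 = q ^ 4"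
    unfolding q(1)[symmetric] power_mult[symmetric] by simp_all
  then show "qtheta (-1) 5 1 t = qpoch_inf (q ^ 3) (q ^ 5) * qpoch_inf (q ^ 2) (q ^ 5) * qpoch_inf (q ^ 5) (q ^ 5)"
    "qtheta (-1) 5 3 t = qpoch_inf (q ^ 4) (q ^ 5) * qpoch_inf q (q ^ 5) * qpoch_inf (q ^ 5) (q ^ 5)"
    using t q by (simp_all add: qtheta_product)
qed

lemma rr_product:
  assumes q: "q \<noteq> 0" "norm q < 1"
  shows "rr_G q = 1 / (qpoch_inf q (q ^ 5) * qpoch_inf (q ^ 4) (q ^ 5))"
    and "rr_H q = 1 / (qpoch_inf (q ^ 2) (q ^ 5) * qpoch_inf (q ^ 3) (q ^ 5))"
proof -
  define t where "t = csqrt q"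
  have tq: "t\<^sup>2 = q" by (simp add: t_def)
  then have t: "t \<noteq> 0" "norm t < 1"
    using q by (auto simp: norm_power power_less_one_iff)
  note nz = qpoch_inf_power_nonzero(1)[OF q(2), of 5 1, simplified]
    qpoch_inf_power_nonzero(1)[OF q(2), of 5 2] qpoch_inf_power_nonzero(1)[OF q(2), of 5 3]
    qpoch_inf_power_nonzero(1)[OF q(2), of 5 4] qpoch_inf_power_nonzero(1)[OF q(2), of 5 5]
  show "rr_G q = 1 / (qpoch_inf q (q ^ 5) * qpoch_inf (q ^ 4) (q ^ 5))"
    using rogers_ramanujan(1)[OF t] nz
    unfolding tq qtheta_neg_one_5_product[OF tq q] euler_E_multisection5[OF q(2)]
    by (simp add: field_simps)
  show "rr_H q = 1 / (qpoch_inf (q ^ 2) (q ^ 5) * qpoch_inf (q ^ 3) (q ^ 5))"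
    using rogers_ramanujan(2)[OF t] nz
    unfolding tq qtheta_neg_one_5_product[OF tq q] euler_E_multisection5[OF q(2)]
    by (simp add: field_simps)
qed

text \<open>All quantities become products over residue classes modulo 10 or 20. Two relations
  suffice: splitting a class into two of twice the modulus, and
  \<open>(1 - x)(1 + x) = 1 - x^2\<close>. After cancellation three factors remain, which the triple
  product recognises as a theta function.\<close>

lemma rr_product_theta:
  assumes q: "q \<noteq> 0" "norm q < 1"
  shows "euler_E (q ^ 2) * rr_G q * rr_G (- q) = qtheta 1 5 1 q"
    and "euler_E (q ^ 2) * rr_H q * rr_H (- q) = qtheta 1 5 3 q"
    and "euler_E (q ^ 2) * rr_G q * rr_H (q ^ 4) = qtheta 1 5 4 q"
    and "euler_E (q ^ 2) * rr_H q * rr_G (q ^ 4) = qtheta 1 5 2 q"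
proof -
  define P where "P a m = qpoch_inf (q ^ a) (q ^ m)" for a m
  define N where "N a m = qpoch_inf (- (q ^ a)) (q ^ m)" for a m
  have nz: "P a m \<noteq> 0" "N a m \<noteq> 0" if "0 < a" "0 < m" for a m
    using qpoch_inf_power_nonzero[OF q(2) that(2,1)] by (simp_all add: P_def N_def)
  have dbl: "P a m = P a (2 * m) * P (a + m) (2 * m)" if "0 < m" for a m
    unfolding P_def by (rule qpoch_inf_power_double[OF q(2) that])
  have sq: "P (2 * a) (2 * m) = P a m * N a m" if "0 < m" for a m
    unfolding P_def N_def by (rule qpoch_inf_power_square[OF q(2) that])
  have E: "euler_E (q ^ 2) = P 2 10 * P 4 10 * P 6 10 * P 8 10 * P 10 10"
    using euler_E_multisection5[OF norm_power_less_one[OF q(2), of 2]]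
    by (simp add: P_def power_mult[symmetric])
  have G: "rr_G q = 1 / (P 1 5 * P 4 5)" and H: "rr_H q = 1 / (P 2 5 * P 3 5)"
    using rr_product[OF q] by (simp_all add: P_def)
  have q4: "q ^ 4 \<noteq> 0" "norm (q ^ 4) < 1" using q norm_power_less_one[of q 4] by auto
  have G4: "rr_G (q ^ 4) = 1 / (P 4 20 * P 16 20)" and H4: "rr_H (q ^ 4) = 1 / (P 8 20 * P 12 20)"
    using rr_product[OF q4] by (simp_all add: P_def power_mult[symmetric])
  \<comment> \<open>Replacing \<open>q\<close> by \<open>-q\<close> gives base
    \<open>-(q^5)\<close>; one splitting restores the base \<open>q^10\<close> and puts the sign
    into every second factor.\<close>
  have md: "qpoch_inf a (- (q ^ 5)) = qpoch_inf a (q ^ 10) * qpoch_inf (- (a * q ^ 5)) (q ^ 10)" for a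
    using qpoch_inf_double[of "- (q ^ 5)" a] norm_power_less_one[OF q(2), of 5]
    by (simp add: power_mult[symmetric])
  have qq: "q * q ^ 5 = q ^ 6" "q ^ 4 * q ^ 5 = q ^ 9" "q ^ 2 * q ^ 5 = q ^ 7" "q ^ 3 * q ^ 5 = q ^ 8"
    by (simp_all add: eval_nat_numeral)
  have Gm: "rr_G (- q) = 1 / ((N 1 10 * P 6 10) * (P 4 10 * N 9 10))"
    using rr_product(1)[of "- q"] q by (simp add: md P_def N_def qq)
  have Hm: "rr_H (- q) = 1 / ((P 2 10 * N 7 10) * (N 3 10 * P 8 10))"
    using rr_product(2)[of "- q"] q by (simp add: md P_def N_def qq)
  have qtheta: "qtheta 1 5 1 q = N 6 10 * N 4 10 * P 10 10" "qtheta 1 5 3 q = N 8 10 * N 2 10 * P 10 10"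
    "qtheta 1 5 4 q = N 9 10 * N 1 10 * P 10 10" "qtheta 1 5 2 q = N 7 10 * N 3 10 * P 10 10"
    using q by (simp_all add: qtheta_product P_def N_def)
  have d5: "P 1 5 = P 1 10 * P 6 10" "P 4 5 = P 4 10 * P 9 10" "P 2 5 = P 2 10 * P 7 10" "P 3 5 = P 3 10 * P 8 10"
    using dbl[of 5 1] dbl[of 5 4] dbl[of 5 2] dbl[of 5 3] by simp_all
  have d10: "P 2 10 = P 2 20 * P 12 20" "P 8 10 = P 8 20 * P 18 20"
    "P 4 10 = P 4 20 * P 14 20" "P 6 10 = P 6 20 * P 16 20"
    using dbl[of 10 2] dbl[of 10 8] dbl[of 10 4] dbl[of 10 6] by simp_all
  have s: "P 2 20 = P 1 10 * N 1 10" "P 18 20 = P 9 10 * N 9 10" "P 6 20 = P 3 10 * N 3 10" "P 14 20 = P 7 10 * N 7 10"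
    "P 8 20 = P 4 10 * N 4 10" "P 12 20 = P 6 10 * N 6 10" "P 4 20 = P 2 10 * N 2 10" "P 16 20 = P 8 10 * N 8 10"
    using sq[of 10 1] sq[of 10 9] sq[of 10 3] sq[of 10 7] sq[of 10 4] sq[of 10 6] sq[of 10 2] sq[of 10 8] by simp_all
  have nz20: "P 8 20 \<noteq> 0" "P 12 20 \<noteq> 0" "P 4 20 \<noteq> 0" "P 16 20 \<noteq> 0" by (simp_all add: nz)
  have e1: "P 2 10 * P 8 10 = (P 1 10 * N 1 10) * (P 9 10 * N 9 10) * (P 8 20 * P 12 20)"
    unfolding d10 s(1,2) by (simp add: mult_ac)
  have e2: "P 4 10 * P 6 10 = (P 3 10 * N 3 10) * (P 7 10 * N 7 10) * (P 4 20 * P 16 20)"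
    unfolding d10(3,4) s(3,4) by (simp add: mult_ac)
  have "euler_E (q ^ 2) * rr_G q * rr_G (- q)
     = (P 2 10 * P 8 10) * (P 4 10 * P 6 10) * P 10 10 / ((P 1 10 * N 1 10) * (P 9 10 * N 9 10) * (P 4 10 * P 6 10)\<^sup>2)"
    unfolding E G Gm d5 by (simp add: power2_eq_square mult_ac)
  also have "\<dots> = N 6 10 * N 4 10 * P 10 10"
    unfolding e1 s using nz by (simp add: divide_simps power2_eq_square)
  finally show "euler_E (q ^ 2) * rr_G q * rr_G (- q) = qtheta 1 5 1 q" by (simp add: qtheta)
  have "euler_E (q ^ 2) * rr_H q * rr_H (- q)
     = (P 4 10 * P 6 10) * (P 2 10 * P 8 10) * P 10 10 / ((P 3 10 * N 3 10) * (P 7 10 * N 7 10) * (P 2 10 * P 8 10)\<^sup>2)"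
    unfolding E H Hm d5 by (simp add: power2_eq_square mult_ac)
  also have "\<dots> = N 8 10 * N 2 10 * P 10 10"
    unfolding e2 s using nz by (simp add: divide_simps power2_eq_square)
  finally show "euler_E (q ^ 2) * rr_H q * rr_H (- q) = qtheta 1 5 3 q" by (simp add: qtheta)
  have "euler_E (q ^ 2) * rr_G q * rr_H (q ^ 4)
     = (P 2 10 * P 8 10) * (P 4 10 * P 6 10) * P 10 10 / (P 1 10 * P 9 10 * (P 4 10 * P 6 10) * (P 8 20 * P 12 20))"
    unfolding E G H4 d5 by (simp add: mult_ac)
  also have "\<dots> = N 9 10 * N 1 10 * P 10 10"
    unfolding e1 using nz nz20 by (simp add: divide_simps)
  finally show "euler_E (q ^ 2) * rr_G q * rr_H (q ^ 4) = qtheta 1 5 4 q" by (simp add: qtheta)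
  have "euler_E (q ^ 2) * rr_H q * rr_G (q ^ 4)
     = (P 4 10 * P 6 10) * (P 2 10 * P 8 10) * P 10 10 / (P 3 10 * P 7 10 * (P 2 10 * P 8 10) * (P 4 20 * P 16 20))"
    unfolding E H G4 d5 by (simp add: mult_ac)
  also have "\<dots> = N 7 10 * N 3 10 * P 10 10"
    unfolding e2 using nz nz20 by (simp add: divide_simps)
  finally show "euler_E (q ^ 2) * rr_H q * rr_G (q ^ 4) = qtheta 1 5 2 q" by (simp add: qtheta)
qed

subsection \<open>The functions \<open>\<phi>\<close> and \<open>\<psi>\<close>\<close>

lemma ram_phi_eq_qtheta: "ram_phi q = qtheta 1 1 0 q"
  by (simp add: ram_phi_def qtheta_def)

lemma ram_psi_eq_infsum:
  assumes q: "norm q < 1"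
  shows "((\<lambda>n::nat. q ^ (n * (n + 1) div 2)) has_sum ram_psi q) UNIV"
proof -
  have "summable (\<lambda>n. norm (q ^ (n * (n + 1) div 2)))"
  proof (rule summable_comparison_test_ev)
    show "summable (\<lambda>n. norm q ^ n)" using q by (simp add: summable_geometric)
    have "n \<le> n * (n + 1) div 2" for n :: nat
      by (cases n) (auto simp: less_eq_div_iff_mult_less_eq)
    then show "\<forall>\<^sub>F n in sequentially. norm (norm (q ^ (n * (n + 1) div 2))) \<le> norm q ^ n"
      using q by (auto simp: norm_power intro!: always_eventually power_decreasing)
  qed
  from norm_summable_imp_has_sum[OF this summable_sums[OF summable_norm_cancel[OF this]]]
  show ?thesis unfolding ram_psi_def .
qed

text \<open>The index \<open>N = 2k\<close> corresponds to the integer \<open>k\<close> and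
  \<open>N = 2k + 1\<close> to \<open>-k - 1\<close>; in both cases \<open>N(N+1)/2\<close> is
  \<open>2a^2 + a\<close> at that integer \<open>a\<close>.\<close>

lemma ram_psi_eq_qtheta:
  assumes q: "norm q < 1"
  shows "ram_psi q = qtheta 1 2 1 q"
proof -
  have "qtheta 1 2 1 q = infsum (\<lambda>n::nat. q ^ (n * (n + 1) div 2)) UNIV"
    unfolding qtheta_def
  proof (rule infsum_reindex_bij_witness[of _ "\<lambda>n. if even n then int (n div 2) else - int (n div 2) - 1"
        "\<lambda>n. if n \<ge> 0 then nat (2 * n) else nat (- 2 * n - 1)"])
    fix a :: int
    define N where "N = (if a \<ge> 0 then nat (2 * a) else nat (- 2 * a - 1))"
    have "q ^ (N * (N + 1) div 2) = 1 powi a * q powi (2 * a\<^sup>2 + 1 * a)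
       \<and> (if even N then int (N div 2) else - int (N div 2) - 1) = a"
    proof (cases a rule: int_cases)
      case (nonneg n)
      then have N: "N = 2 * n" by (simp add: N_def)
      have a: "2 * a\<^sup>2 + 1 * a = int (n * (2 * n + 1))" by (simp add: nonneg power2_eq_square algebra_simps)
      have "N * (N + 1) div 2 = n * (2 * n + 1)" by (simp add: N)
      moreover have "(if even N then int (N div 2) else - int (N div 2) - 1) = a" by (simp add: N nonneg)
      ultimately show ?thesis unfolding a power_int_of_nat by simp
    next
      case (neg n)
      then have N: "N = 2 * n + 1" unfolding N_def by (simp only: nat_eq_iff2 split: if_splits) auto
      have a: "2 * a\<^sup>2 + 1 * a = int ((2 * n + 1) * (n + 1))"
        unfolding neg power2_eq_square by (simp add: algebra_simps)
      have "N * (N + 1) = 2 * ((2 * n + 1) * (n + 1))" by (simp add: N)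
      then have "N * (N + 1) div 2 = (2 * n + 1) * (n + 1)" by simp
      moreover have "(if even N then int (N div 2) else - int (N div 2) - 1) = a" unfolding N neg by simp
      ultimately show ?thesis unfolding a power_int_of_nat by simp
    qed
    then show "q ^ ((if a \<ge> 0 then nat (2 * a) else nat (- 2 * a - 1)) *
         ((if a \<ge> 0 then nat (2 * a) else nat (- 2 * a - 1)) + 1) div 2) = 1 powi a * q powi (2 * a\<^sup>2 + 1 * a)"
      "(if even (if a \<ge> 0 then nat (2 * a) else nat (- 2 * a - 1))
         then int ((if a \<ge> 0 then nat (2 * a) else nat (- 2 * a - 1)) div 2)
         else - int ((if a \<ge> 0 then nat (2 * a) else nat (- 2 * a - 1)) div 2) - 1) = a"
      unfolding N_def by blast+
  next
    fix b :: nat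
    show "(if (if even b then int (b div 2) else - int (b div 2) - 1) \<ge> 0
       then nat (2 * (if even b then int (b div 2) else - int (b div 2) - 1))
       else nat (- 2 * (if even b then int (b div 2) else - int (b div 2) - 1) - 1)) = b"
      by (cases "even b") (auto elim!: evenE oddE)
  qed auto
  then show ?thesis using ram_psi_eq_infsum[OF q] infsumI by fastforce
qed

text \<open>The reflection \<open>n\<close> to \<open>-1 - n\<close> fixes \<open>n^2 + n\<close>,
  so the two half-lines contribute equally.\<close>

lemma qtheta_1_1_1:
  assumes t: "t \<noteq> 0" "norm t < 1"
  shows "qtheta 1 1 1 t = 2 * ram_psi (t\<^sup>2)"
proof -
  have t2: "norm (t\<^sup>2) < 1" using norm_power_less_one[OF t(2), of 2] by simp
  define f where "f n = t powi (n\<^sup>2 + n)" for n :: int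
  have f: "f (int n) = (t\<^sup>2) ^ (n * (n + 1) div 2)" for n
  proof -
    have "f (int n) = t powi int (n * (n + 1))" by (simp add: f_def power2_eq_square algebra_simps)
    also have "n * (n + 1) = 2 * (n * (n + 1) div 2)" by simp
    finally show ?thesis by (simp only: power_int_of_nat power_mult)
  qed
  have "((\<lambda>n. f (int n)) has_sum ram_psi (t\<^sup>2)) UNIV"
    unfolding f by (rule ram_psi_eq_infsum[OF t2])
  then have 1: "(f has_sum ram_psi (t\<^sup>2)) {0..}"
    by (subst has_sum_reindex_bij_witness[of _ int nat UNIV "\<lambda>n. f (int n)"]) auto
  have 2: "(f has_sum ram_psi (t\<^sup>2)) {..<0}"
  proof (subst has_sum_reindex_bij_witness[of _ "\<lambda>n. - 1 - n" "\<lambda>n. - 1 - n" "{0..}" f])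
    show "(f has_sum ram_psi (t\<^sup>2)) {0..}" by (rule 1)
    show "f (- 1 - a) = f a" for a
      unfolding f_def by (rule arg_cong[where f = "\<lambda>x. t powi x"]) (simp add: power2_eq_square algebra_simps)
  qed auto
  have "(f has_sum (ram_psi (t\<^sup>2) + ram_psi (t\<^sup>2))) ({0..} \<union> {..<0})"
    by (intro has_sum_Un_disjoint 1 2) auto
  moreover have "{0..} \<union> {..<0} = (UNIV :: int set)" by auto
  ultimately have "infsum f UNIV = 2 * ram_psi (t\<^sup>2)" using infsumI by fastforce
  then show ?thesis by (simp add: qtheta_def f_def[abs_def])
qed

lemma euler_E_minus: "norm q < 1 \<Longrightarrow> euler_E (- q) = qpoch_inf (- q) (q\<^sup>2) * euler_E (q\<^sup>2)"
  using qpoch_inf_double[of "- q" "- q"] by (simp add: euler_E_def power2_eq_square)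

lemma ram_phi_euler_E:
  assumes q: "q \<noteq> 0" "norm q < 1"
  shows "ram_phi q * euler_E (q\<^sup>2) = (euler_E (- q))\<^sup>2"
  using q unfolding euler_E_minus[OF q(2)] ram_phi_eq_qtheta
  by (subst qtheta_product) (auto simp: euler_E_def power2_eq_square)

text \<open>The right side pairs the arguments \<open>q\<close> and \<open>-q\<close>, at which the
  relation between the two functions U is used for the quotient with \<open>\<phi>\<close>.\<close>

lemma ram_phi_minus_euler_E:
  assumes q: "q \<noteq> 0" "norm q < 1"
  shows "ram_phi (- (q\<^sup>2)) * euler_E (q\<^sup>2) = euler_E q * euler_E (- q)"
proof -
  have q2: "- (q\<^sup>2) \<noteq> 0" "norm (- (q\<^sup>2)) < 1" using q norm_power_less_one[of q 2] by auto
  have "ram_phi (- (q\<^sup>2)) * euler_E (q ^ 4) = (euler_E (q\<^sup>2))\<^sup>2"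
    using ram_phi_euler_E[OF q2] by (simp add: power_mult[symmetric])
  moreover have "euler_E (q\<^sup>2) = qpoch_inf (q\<^sup>2) (q ^ 4) * euler_E (q ^ 4)"
    using euler_E_minus[of "- (q\<^sup>2)"] q2 by (simp add: power_mult[symmetric])
  moreover have "euler_E q = qpoch_inf q (q\<^sup>2) * euler_E (q\<^sup>2)"
    using euler_E_minus[of "- q"] q by simp
  moreover have "qpoch_inf (q\<^sup>2) (q ^ 4) = qpoch_inf q (q\<^sup>2) * qpoch_inf (- q) (q\<^sup>2)"
    using qpoch_inf_power_square[OF q(2), of 2 1] by simp
  moreover have "euler_E (q ^ 4) \<noteq> 0" using euler_E_nonzero norm_power_less_one[OF q(2), of 4] by simp
  ultimately show ?thesis using euler_E_minus[OF q(2)]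
    by (simp add: power2_eq_square mult_ac)
qed

lemma ram_psi_euler_E:
  assumes q: "q \<noteq> 0" "norm q < 1"
  shows "ram_psi q * euler_E (q\<^sup>2) = euler_E (- q) * euler_E (q ^ 4)"
proof -
  have "ram_psi q = qpoch_inf (- (q ^ 3)) (q ^ 4) * qpoch_inf (- q) (q ^ 4) * euler_E (q ^ 4)"
    unfolding ram_psi_eq_qtheta[OF q(2)] using q by (subst qtheta_product) (auto simp: euler_E_def)
  moreover have "qpoch_inf (- q) (q\<^sup>2) = qpoch_inf (- q) (q ^ 4) * qpoch_inf (- (q ^ 3)) (q ^ 4)"
    using qpoch_inf_double[of "q\<^sup>2" "- q"] norm_power_less_one[OF q(2), of 2]
    by (simp add: power_mult[symmetric]) (simp add: eval_nat_numeral)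
  ultimately show ?thesis using euler_E_minus[OF q(2)] by simp
qed

text \<open>The right side pairs the arguments \<open>q\<close> and \<open>q^4\<close>, at which the
  relation between the two functions U is used for the quotient with \<open>\<psi>\<close>.\<close>

lemma ram_psi_minus_euler_E:
  assumes q: "q \<noteq> 0" "norm q < 1"
  shows "ram_psi (- q) * euler_E (q\<^sup>2) = euler_E q * euler_E (q ^ 4)"
  using ram_psi_euler_E[of "- q"] q by simp

subsection \<open>Splitting lattice sums\<close>

text \<open>Points are sorted by the residue \<open>d\<close> of \<open>n - a m\<close> modulo
  \<open>M\<close>, with quotient \<open>j\<close>; then \<open>m = i - c j\<close> shears the
  remaining lattice. In the applications \<open>a\<close> and \<open>c\<close> are chosen so that
  the exponent has no \<open>i j\<close> term and each class becomes a product of two theta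
  functions.\<close>

lemma infsum_split_residues:
  fixes F :: "int \<Rightarrow> int \<Rightarrow> complex"
  assumes F: "(\<lambda>(n, m). F n m) summable_on UNIV" and M: "M > 0"
  shows "infsum (\<lambda>(n, m). F n m) UNIV
    = (\<Sum>d\<in>{lo..<lo + M}. infsum (\<lambda>(i, j). F (M * j + d + a * (i - c * j)) (i - c * j)) UNIV)"
proof -
  define h where "h = (\<lambda>(d, i, j). (M * j + d + a * (i - c * j), i - c * j))"
  define g where "g = (\<lambda>(n, m). let l = n - a * m; j = (l - lo) div M in (l - M * j, m + c * j, j))"
  have gh: "g (h x) = x" if "x \<in> {lo..<lo + M} \<times> UNIV" for x
  proof -
    obtain d i j where x: "x = (d, i, j)" by (cases x)
    have "(M * j + d - lo) div M = ((d - lo) + j * M) div M" by (simp add: algebra_simps)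
    also have "\<dots> = j + (d - lo) div M" using M by (intro div_mult_self1) auto
    also have "(d - lo) div M = 0" using that x by (auto intro: div_pos_pos_trivial)
    finally show ?thesis by (simp add: g_def h_def x Let_def)
  qed
  have hg: "h (g y) = y" for y
    by (auto simp: g_def h_def Let_def case_prod_unfold)
  have gin: "g y \<in> {lo..<lo + M} \<times> UNIV" for y
  proof -
    obtain n m where y: "y = (n, m)" by (cases y)
    define l where "l = n - a * m"
    have "l - M * ((l - lo) div M) = lo + (l - lo) mod M"
      by (simp add: minus_mult_div_eq_mod [symmetric])
    moreover have "0 \<le> (l - lo) mod M" "(l - lo) mod M < M" using M by simp_all
    ultimately show ?thesis by (auto simp: g_def Let_def y l_def)
  qed
  have "bij_betw h ({lo..<lo + M} \<times> UNIV) UNIV"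
    by (rule bij_betwI[of _ _ _ g]) (use gh hg gin in auto)
  then have eq: "infsum (\<lambda>x. case h x of (n, m) \<Rightarrow> F n m) ({lo..<lo + M} \<times> UNIV) = infsum (\<lambda>(n, m). F n m) UNIV"
    and sm: "(\<lambda>x. case h x of (n, m) \<Rightarrow> F n m) summable_on ({lo..<lo + M} \<times> UNIV)"
    using infsum_reindex_bij_betw[of h _ _ "\<lambda>(n, m). F n m"]
      summable_on_reindex_bij_betw[of h _ _ "\<lambda>(n, m). F n m"] F by auto
  show ?thesis
    unfolding eq[symmetric] infsum_Sigma_banach[OF sm, symmetric]
    by (simp add: h_def case_prod_unfold)
qed

lemma infsum_swap_args:
  fixes F :: "int \<Rightarrow> int \<Rightarrow> complex"
  shows "infsum (\<lambda>(n, m). F n m) UNIV = infsum (\<lambda>(n, m). F m n) UNIV"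
  by (rule infsum_reindex_bij_witness[of _ "\<lambda>(n, m). (m, n)" "\<lambda>(n, m). (m, n)"]) auto

lemma summable_on_swap_args:
  fixes F :: "int \<Rightarrow> int \<Rightarrow> complex"
  assumes "(\<lambda>(n, m). F n m) summable_on UNIV"
  shows "(\<lambda>(n, m). F m n) summable_on UNIV"
  using assms
  by (subst summable_on_reindex_bij_witness[of _ "\<lambda>(n, m). (m, n)" "\<lambda>(n, m). (m, n)" UNIV "\<lambda>(n, m). F n m"]) auto

lemma infsum_qtheta_qtheta:
  fixes F :: "int \<Rightarrow> int \<Rightarrow> complex"
  assumes t: "t \<noteq> 0" "norm t < 1" and e: "e = 1 \<or> e = -1" and ac: "1 \<le> a" "1 \<le> c"
    and F: "\<And>i j. F i j = e powi i * e powi j * t powi X i j"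
    and X: "\<And>i j. X i j = (a * i\<^sup>2 + b * i) + (c * j\<^sup>2 + d * j) + K"
  shows "infsum (\<lambda>(i, j). F i j) UNIV = t powi K * qtheta e a b t * qtheta e c d t"
proof -
  have F': "F i j = (t powi K * (e powi i * t powi (a * i\<^sup>2 + b * i))) * (e powi j * t powi (c * j\<^sup>2 + d * j))" for i j
    using t by (simp add: F X power_int_add)
  show ?thesis
    unfolding F' qtheta_def
    by (subst infsum_prod_mult) (intro summable_on_cmult_right summable_on_qtheta t e ac | simp only: infsum_cmult_right')+
qed

section \<open>Transformations of theta functions in one variable\<close>

lemma qtheta_power: "qtheta e a b (t ^ n) = qtheta e (int n * a) (int n * b) t"
  by (simp add: qtheta_def power_int_power algebra_simps)

lemma qtheta_shift:
  assumes t: "t \<noteq> 0" and e: "e = 1 \<or> e = -1"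
  shows "qtheta e a (b + 2 * a) t = e * t powi (- (a + b)) * qtheta e a b t"
proof -
  have "qtheta e a (b + 2 * a) t = infsum (\<lambda>n. (e * t powi (- (a + b))) * (e powi n * t powi (a * n\<^sup>2 + b * n))) UNIV"
    unfolding qtheta_def
  proof (rule infsum_reindex_bij_witness[of _ "\<lambda>n. n - 1" "\<lambda>n. n + 1"])
    fix n :: int
    have "e powi (n + 1) = e powi n * e" using e by (auto simp: power_int_add)
    then have "e powi n = e * e powi (n + 1)" using e by auto
    moreover have "t powi (a * n\<^sup>2 + (b + 2 * a) * n) = t powi (- (a + b)) * t powi (a * (n + 1)\<^sup>2 + b * (n + 1))"
      using t by (simp flip: power_int_add) (simp add: power2_eq_square algebra_simps)
    ultimately show "e * t powi (- (a + b)) * (e powi (n + 1) * t powi (a * (n + 1)\<^sup>2 + b * (n + 1)))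
       = e powi n * t powi (a * n\<^sup>2 + (b + 2 * a) * n)"
      by simp
  qed auto
  also have "\<dots> = e * t powi (- (a + b)) * qtheta e a b t" unfolding qtheta_def by (rule infsum_cmult_right')
  finally show ?thesis .
qed

text \<open>Shifting the linear coefficient from \<open>-a\<close> to \<open>a\<close> costs the
  factor \<open>-1\<close> and no power of \<open>t\<close>, whereas reflection costs
  nothing.\<close>

lemma qtheta_neg_one_diag:
  assumes "t \<noteq> 0"
  shows "qtheta (-1) a a t = 0"
  using qtheta_shift[of t "-1" a "-a"] qtheta_minus[of "-1" a a t] assms by simp

lemma qtheta_parity_split:
  assumes t: "t \<noteq> 0" "norm t < 1" and a: "1 \<le> a"
  shows "qtheta 1 a b t = qtheta 1 (4 * a) (2 * b) t + t powi (a + b) * qtheta 1 (4 * a) (4 * a + 2 * b) t"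
proof -
  define f where "f n = t powi (a * n\<^sup>2 + b * n)" for n
  have sm: "f summable_on A" for A
    using summable_on_qtheta[OF t, of 1 a b] a unfolding f_def[abs_def]
    by (auto intro: summable_on_subset_banach)
  have "infsum f ({n. even n} \<union> {n. odd n}) = infsum f {n. even n} + infsum f {n. odd n}"
    by (rule infsum_Un_disjoint) (auto simp: sm)
  moreover have "{n. even n} \<union> {n. odd n} = (UNIV :: int set)" by auto
  moreover have "infsum f {n. even n} = qtheta 1 (4 * a) (2 * b) t"
    unfolding qtheta_def
    by (rule infsum_reindex_bij_witness[of _ "\<lambda>n. 2 * n" "\<lambda>n. n div 2"])
       (auto simp: f_def power2_eq_square algebra_simps elim!: evenE)
  moreover have "infsum f {n. odd n} = infsum (\<lambda>n. t powi (a + b) * (1 powi n * t powi (4 * a * n\<^sup>2 + (4 * a + 2 * b) * n))) UNIV"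
  proof (rule infsum_reindex_bij_witness[of _ "\<lambda>n. 2 * n + 1" "\<lambda>n. n div 2"])
    fix n :: int assume "n \<in> {n. odd n}"
    then obtain k where n: "n = 2 * k + 1" by (auto elim: oddE)
    then have "n div 2 = k" by simp
    moreover have "t powi (a * n\<^sup>2 + b * n) = t powi (a + b) * t powi (4 * a * k\<^sup>2 + (4 * a + 2 * b) * k)"
      unfolding n using t by (simp flip: power_int_add) (simp add: power2_eq_square algebra_simps)
    ultimately show "t powi (a + b) * (1 powi (n div 2) * t powi (4 * a * (n div 2)\<^sup>2 + (4 * a + 2 * b) * (n div 2))) = f n"
      by (simp add: f_def)
  qed (auto elim!: oddE)
  moreover have "\<dots> = t powi (a + b) * qtheta 1 (4 * a) (4 * a + 2 * b) t"
    unfolding qtheta_def by (rule infsum_cmult_right')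
  ultimately show ?thesis by (simp add: qtheta_def f_def[abs_def])
qed

text \<open>Representatives are taken around 0 so that classes pair up by reflection:
  \<open>d\<close> with \<open>-d\<close>, or \<open>2d + 1\<close> with its negative, in which case
  \<open>d = 2\<close> is left alone.\<close>

lemma sum_residues5: "sum f {- 2..<- 2 + 5 :: int} = f (- 2) + f (- 1) + f 0 + f 1 + (f 2 :: complex)"
proof -
  have "{- 2..<- 2 + 5 :: int} = {- 2, - 1, 0, 1, 2}" by auto
  then show ?thesis by (simp add: add_ac)
qed

lemma sum_residues2: "sum f {0..<0 + 2 :: int} = f 0 + (f 1 :: complex)"
proof -
  have "{0..<0 + 2 :: int} = {0, 1}" by auto
  then show ?thesis by simp
qed

lemma sign_powi_diff:
  assumes "e = 1 \<or> e = (-1 :: complex)"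
  shows "e powi (i - j) = e powi i * e powi j"
proof -
  have "e powi (i + (- j)) = e powi i * e powi (- j)" using assms by (intro power_int_add) auto
  then show ?thesis using sign_powi_minus[OF assms] by simp
qed

lemma sign_powi_diff1:
  assumes "e = 1 \<or> e = (-1 :: complex)"
  shows "e powi (i - 1 * j) = e powi i * e powi j"
  using sign_powi_diff[OF assms] by simp

lemma sign_powi_diff3:
  assumes "e = 1 \<or> e = (-1 :: complex)"
  shows "e powi (i - 3 * j) = e powi i * e powi j"
proof -
  have "e powi (3 * j) = (e ^ 3) powi j" by (simp add: power_int_power)
  also have "e ^ 3 = e" using assms by auto
  finally show ?thesis by (simp add: sign_powi_diff[OF assms])
qed

text \<open>For \<open>e = 1\<close> this is the part of the theta series of \<open>(2,1,5)\<close> with odd first coordinate; the quadratic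
  form equals both \<open>(x\<^sup>2 + 39 y\<^sup>2) / 20\<close> and \<open>(3 x\<^sup>2 + 13 y\<^sup>2) / 20\<close> on sublattices of index 10.\<close>

definition form39 :: "complex \<Rightarrow> complex \<Rightarrow> complex" where
  "form39 e t = infsum (\<lambda>(l, k). e powi k * t powi (2 * (2 * l + 1)\<^sup>2 + (2 * l + 1) * k + 5 * k\<^sup>2)) UNIV"

lemma summable_on_form:
  fixes q e :: complex
  assumes q: "q \<noteq> 0" "norm q < 1" and e: "e = 1 \<or> e = -1"
    and K: "0 < K" and le: "\<And>n m. n\<^sup>2 + m\<^sup>2 \<le> int K * X n m"
  shows "(\<lambda>(n, m). e powi m * q powi X n m) summable_on UNIV"
proof -
  have "(\<lambda>x. (e powi snd x) * q powi (X (fst x) (snd x))) summable_on UNIV"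
    using le by (intro summable_on_powi_int2[where K = K and c = "\<lambda>x. e powi snd x"] q K norm_sign_powi_le[OF e]) auto
  then show ?thesis by (simp add: case_prod_unfold)
qed

lemma summable_on_form39:
  fixes t e :: complex
  assumes t: "t \<noteq> 0" "norm t < 1" and e: "e = 1 \<or> e = -1"
  shows "(\<lambda>(l, k). e powi k * t powi (2 * (2 * l + 1)\<^sup>2 + (2 * l + 1) * k + 5 * k\<^sup>2)) summable_on UNIV"
proof (rule summable_on_form[where K = 1])
  fix l k :: int
  \<comment> \<open>Twice the difference of the two sides of the bound that follows.\<close>
  have "0 \<le> (2 * l + 1 + k)\<^sup>2 + (2 * l + 1)\<^sup>2 + 7 * k\<^sup>2" by simp
  then have 1: "(2 * l + 1)\<^sup>2 + k\<^sup>2 \<le> 2 * (2 * l + 1)\<^sup>2 + (2 * l + 1) * k + 5 * k\<^sup>2"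
    by (simp add: power2_eq_square algebra_simps)
  have "\<bar>l\<bar> \<le> \<bar>2 * l + 1\<bar>" by linarith
  then have "l\<^sup>2 \<le> (2 * l + 1)\<^sup>2" by (rule abs_le_square_iff[THEN iffD1])
  with 1 show "l\<^sup>2 + k\<^sup>2 \<le> int 1 * (2 * (2 * l + 1)\<^sup>2 + (2 * l + 1) * k + 5 * k\<^sup>2)" by simp
qed (use t e in auto)

text \<open>With \<open>x = 2l + 1\<close> one has
  \<open>20(2x^2 + xk + 5k^2) = (10k + x)^2 + 39x^2\<close>. Sorting \<open>l\<close> modulo 5 puts
  both \<open>10k + x\<close> and \<open>x\<close> into the class of \<open>2d + 1\<close> modulo
  10.\<close>

lemma form39_split_39:
  assumes t: "t \<noteq> 0" "norm t < 1" and e: "e = 1 \<or> e = -1"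
  shows "form39 e t = 2 * t ^ 2 * qtheta e 5 1 t * qtheta e 5 1 (t ^ 39) + 2 * t ^ 18 * qtheta e 5 3 t * qtheta e 5 3 (t ^ 39)
     + t ^ 50 * qtheta e 5 5 t * qtheta e 5 5 (t ^ 39)"
proof -
  have *: "infsum (\<lambda>(i, j). e powi (i - 1 * j) * t powi (2 * (2 * (5 * j + d + 0 * (i - 1 * j)) + 1)\<^sup>2
        + (2 * (5 * j + d + 0 * (i - 1 * j)) + 1) * (i - 1 * j) + 5 * (i - 1 * j)\<^sup>2)) UNIV
      = t powi (2 * (2 * d + 1)\<^sup>2) * qtheta e 5 (2 * d + 1) t * qtheta e 195 (39 * (2 * d + 1)) t" for d
    by (rule infsum_qtheta_qtheta[OF t e _ _ arg_cong2[where f = "(*)", OF sign_powi_diff1[OF e] refl]]) (simp_all add: power2_eq_square algebra_simps)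
  show ?thesis
    unfolding form39_def infsum_split_residues[where M = 5 and lo = "-2" and a = 0 and c = 1, OF summable_on_form39[OF t e] zero_less_numeral]
      sum_residues5 *
    using qtheta_minus[OF e, of 5 1 t] qtheta_minus[OF e, of 5 3 t] qtheta_minus[OF e, of 195 39 t] qtheta_minus[OF e, of 195 117 t]
    by (simp add: qtheta_power)
qed

text \<open>With \<open>x = 2l + 1\<close> one has
  \<open>20(2x^2 + xk + 5k^2) = 3(3x + 4k)^2 + 13(x - 2k)^2\<close>. The residue is now that of
  \<open>l - k\<close> modulo 5, which puts \<open>x - 2k\<close> into the class of
  \<open>2d + 1\<close> modulo 10 and \<open>3x + 4k\<close> into that of
  \<open>3(2d + 1)\<close>.\<close>

lemma form39_split_13:
  assumes t: "t \<noteq> 0" "norm t < 1" and e: "e = 1 \<or> e = -1"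
  shows "form39 e t = 2 * t ^ 2 * qtheta e 5 3 (t ^ 3) * qtheta e 5 1 (t ^ 13) + 2 * e * t ^ 6 * qtheta e 5 1 (t ^ 3) * qtheta e 5 3 (t ^ 13)
     + e * t ^ 20 * qtheta e 5 5 (t ^ 3) * qtheta e 5 5 (t ^ 13)"
proof -
  have *: "infsum (\<lambda>(i, j). e powi (i - 3 * j) * t powi (2 * (2 * (5 * j + d + 1 * (i - 3 * j)) + 1)\<^sup>2
        + (2 * (5 * j + d + 1 * (i - 3 * j)) + 1) * (i - 3 * j) + 5 * (i - 3 * j)\<^sup>2)) UNIV
      = t powi (2 * (2 * d + 1)\<^sup>2) * qtheta e 15 (9 * (2 * d + 1)) t * qtheta e 65 (13 * (2 * d + 1)) t" for d
    by (rule infsum_qtheta_qtheta[OF t e _ _ arg_cong2[where f = "(*)", OF sign_powi_diff3[OF e] refl]]) (simp_all add: power2_eq_square algebra_simps)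
  \<comment> \<open>The linear coefficients 27 and 45 are reduced modulo 30 to -3 and 15. Each shift
    brings a factor \<open>e\<close>, the source of the minus sign in U(3,13), and lowers the powers
    18 and 50 to 6 and 20.\<close>
  have 12: "t ^ 12 * qtheta e 15 27 t = e * qtheta e 15 3 t" and 30: "t ^ 30 * qtheta e 15 45 t = e * qtheta e 15 15 t"
    using qtheta_shift[OF t(1) e, of 15 "-3"] qtheta_shift[OF t(1) e, of 15 15] qtheta_minus[OF e, of 15 3 t] t
    by (simp_all add: power_int_minus field_simps)
  have "t ^ 18 * qtheta e 15 27 t = t ^ 6 * (t ^ 12 * qtheta e 15 27 t)" "t ^ 50 * qtheta e 15 45 t = t ^ 20 * (t ^ 30 * qtheta e 15 45 t)"
    by (simp_all flip: mult.assoc power_add)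
  then have sh: "t ^ 18 * qtheta e 15 27 t = e * t ^ 6 * qtheta e 15 3 t" "t ^ 50 * qtheta e 15 45 t = e * t ^ 20 * qtheta e 15 15 t"
    unfolding 12 30 by simp_all
  show ?thesis
    unfolding form39_def infsum_split_residues[where M = 5 and lo = "-2" and a = 1 and c = 3, OF summable_on_form39[OF t e] zero_less_numeral]
      sum_residues5 *
    using qtheta_minus[OF e, of 15 9 t] qtheta_minus[OF e, of 15 27 t] qtheta_minus[OF e, of 65 13 t] qtheta_minus[OF e, of 65 39 t] sh
    by (simp add: qtheta_power)
qed

subsection \<open>Theta series of the binary forms\<close>

lemma infsum_qtheta_qtheta1:
  assumes t: "t \<noteq> 0" "norm t < 1" and ac: "1 \<le> a" "1 \<le> c"
    and X: "\<And>i j. X i j = (a * i\<^sup>2 + b * i) + (c * j\<^sup>2 + d * j) + K"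
  shows "infsum (\<lambda>(i, j). t powi X i j) UNIV = t powi K * qtheta 1 a b t * qtheta 1 c d t"
  by (rule infsum_qtheta_qtheta[OF t _ ac, where e = 1 and X = X]) (use X in auto)

lemma qtheta_1_minus: "qtheta 1 a (- b) t = qtheta 1 a b t"
  by (rule qtheta_minus) simp

lemma summable_on_theta_form:
  fixes q :: complex
  assumes q: "q \<noteq> 0" "norm q < 1" and K: "0 < K"
    and le: "\<And>n m. n\<^sup>2 + m\<^sup>2 \<le> int K * (a * n\<^sup>2 + b * n * m + c * m\<^sup>2)"
  shows "(\<lambda>(n, m). q powi (a * n\<^sup>2 + b * n * m + c * m\<^sup>2)) summable_on UNIV"
  using summable_on_form[OF q _ K le, of 1] by simp

lemma theta_form_diag:
  assumes q: "q \<noteq> 0" "norm q < 1" and ps: "1 \<le> p" "1 \<le> s"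
  shows "theta_form p 0 s q = qtheta 1 p 0 q * qtheta 1 s 0 q"
  unfolding theta_form_def
  by (subst infsum_qtheta_qtheta1[OF q ps, where b = 0 and d = 0 and K = 0]) auto

text \<open>From \<open>4(p n^2 + p n m + c m^2) = p(2n + m)^2 + s m^2\<close>: even
  \<open>m\<close> gives the diagonal form, odd \<open>m\<close> the product of the two remaining
  thetas.\<close>

lemma theta_form_half:
  assumes q: "q \<noteq> 0" "norm q < 1" and ps: "1 \<le> p" "1 \<le> s" "p + s = 4 * c"
  shows "theta_form p p c q = theta_form p 0 s q + q powi c * qtheta 1 p p q * qtheta 1 s s q"
proof -
  have s: "s = 4 * c - p" using ps by simp
  have sm: "(\<lambda>(n, m). q powi (p * n\<^sup>2 + p * n * m + c * m\<^sup>2)) summable_on UNIV"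
  proof (rule summable_on_theta_form[where K = 8])
    fix n m :: int
    have "1 * (2 * n + m)\<^sup>2 \<le> p * (2 * n + m)\<^sup>2" "1 * m\<^sup>2 \<le> s * m\<^sup>2"
      using ps by (intro mult_right_mono; simp)+
    moreover have "p * (2 * n + m)\<^sup>2 + s * m\<^sup>2 = 4 * (p * n\<^sup>2 + p * n * m + c * m\<^sup>2)"
      unfolding s by (simp add: power2_eq_square algebra_simps)
    \<comment> \<open>Seven times the difference of the two sides of the next bound; with the factor
      4 above it accounts for \<open>K = 8\<close>.\<close>
    moreover have "0 \<le> (7 * n + 4 * m)\<^sup>2 + 5 * m\<^sup>2" by simp
    then have "n\<^sup>2 + m\<^sup>2 \<le> 2 * ((2 * n + m)\<^sup>2 + m\<^sup>2)"
      by (simp add: power2_eq_square algebra_simps)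
    ultimately show "n\<^sup>2 + m\<^sup>2 \<le> int 8 * (p * n\<^sup>2 + p * n * m + c * m\<^sup>2)" by simp
  qed (use q in auto)
  have 0: "infsum (\<lambda>(i, j). q powi (p * (i - 1 * j)\<^sup>2 + p * (i - 1 * j) * (2 * j + 0 + 0 * (i - 1 * j))
      + c * (2 * j + 0 + 0 * (i - 1 * j))\<^sup>2)) UNIV = q powi 0 * qtheta 1 p 0 q * qtheta 1 s 0 q"
    by (rule infsum_qtheta_qtheta1[OF q ps(1,2)]) (simp add: s power2_eq_square algebra_simps)
  have 1: "infsum (\<lambda>(i, j). q powi (p * (i - 1 * j)\<^sup>2 + p * (i - 1 * j) * (2 * j + 1 + 0 * (i - 1 * j))
      + c * (2 * j + 1 + 0 * (i - 1 * j))\<^sup>2)) UNIV = q powi c * qtheta 1 p p q * qtheta 1 s s q"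
    by (rule infsum_qtheta_qtheta1[OF q ps(1,2)]) (simp add: s power2_eq_square algebra_simps)
  show ?thesis
    unfolding theta_form_diag[OF q ps(1,2)] theta_form_def[of p p c] infsum_swap_args[of "\<lambda>n m. q powi (p * n\<^sup>2 + p * n * m + c * m\<^sup>2)"]
      infsum_split_residues[where M = 2 and lo = 0 and a = 0 and c = 1, OF summable_on_swap_args[OF sm] zero_less_numeral]
      sum_residues2 0 1
    by simp
qed

lemma theta_2_1_5_diff:
  assumes q: "q \<noteq> 0" "norm q < 1"
  shows "theta_form 2 1 5 q = theta_form 5 2 8 q + form39 1 q"
proof -
  have sm: "(\<lambda>(n, m). q powi (2 * n\<^sup>2 + 1 * n * m + 5 * m\<^sup>2)) summable_on UNIV"
  proof (rule summable_on_theta_form[where K = 1])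
    fix n m :: int
    have "0 \<le> (n + m)\<^sup>2 + n\<^sup>2 + 7 * m\<^sup>2" by simp
    then show "n\<^sup>2 + m\<^sup>2 \<le> int 1 * (2 * n\<^sup>2 + 1 * n * m + 5 * m\<^sup>2)" by (simp add: power2_eq_square algebra_simps)
  qed (use q in auto)
  have 0: "infsum (\<lambda>(i, j). q powi (2 * (2 * j + 0 + 0 * (i - 0 * j))\<^sup>2 + 1 * (2 * j + 0 + 0 * (i - 0 * j)) * (i - 0 * j) + 5 * (i - 0 * j)\<^sup>2)) UNIV
     = theta_form 5 2 8 q"
    unfolding theta_form_def by (rule infsum_cong) (auto simp: power2_eq_square algebra_simps)
  have 1: "infsum (\<lambda>(i, j). q powi (2 * (2 * j + 1 + 0 * (i - 0 * j))\<^sup>2 + 1 * (2 * j + 1 + 0 * (i - 0 * j)) * (i - 0 * j) + 5 * (i - 0 * j)\<^sup>2)) UNIV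
     = form39 1 q"
    unfolding form39_def by (subst infsum_swap_args) simp
  show ?thesis
    unfolding theta_form_def[of 2]
      infsum_split_residues[where M = 2 and lo = 0 and a = 0 and c = 0, OF sm zero_less_numeral] sum_residues2 0 1 ..
qed

lemma summable_on_theta_5_2_8:
  fixes q :: complex
  assumes q: "q \<noteq> 0" "norm q < 1"
  shows "(\<lambda>(n, m). q powi (5 * n\<^sup>2 + 2 * n * m + 8 * m\<^sup>2)) summable_on UNIV"
proof (rule summable_on_theta_form[where K = 1])
  fix n m :: int
  have "0 \<le> (n + m)\<^sup>2 + 3 * n\<^sup>2 + 6 * m\<^sup>2" by simp
  then show "n\<^sup>2 + m\<^sup>2 \<le> int 1 * (5 * n\<^sup>2 + 2 * n * m + 8 * m\<^sup>2)" by (simp add: power2_eq_square algebra_simps)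
qed (use q in auto)

text \<open>Rests on \<open>5(5n^2 + 2nm + 8m^2) = (5n + m)^2 + 39m^2\<close>, with \<open>m\<close>
  sorted modulo 5.\<close>

lemma theta_5_2_8_split_39:
  assumes q: "q \<noteq> 0" "norm q < 1"
  shows "theta_form 5 2 8 q = qtheta 1 5 0 q * qtheta 1 5 0 (q ^ 39) + 2 * q ^ 8 * qtheta 1 5 2 q * qtheta 1 5 2 (q ^ 39)
     + 2 * q ^ 32 * qtheta 1 5 4 q * qtheta 1 5 4 (q ^ 39)"
proof -
  have *: "infsum (\<lambda>(i, j). q powi (5 * (i - 1 * j)\<^sup>2 + 2 * (i - 1 * j) * (5 * j + d + 0 * (i - 1 * j))
      + 8 * (5 * j + d + 0 * (i - 1 * j))\<^sup>2)) UNIV = q powi (8 * d\<^sup>2) * qtheta 1 5 (2 * d) q * qtheta 1 195 (78 * d) q" for d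
    by (rule infsum_qtheta_qtheta1[OF q]) (simp_all add: power2_eq_square algebra_simps)
  show ?thesis
    unfolding theta_form_def infsum_swap_args[of "\<lambda>n m. q powi (5 * n\<^sup>2 + 2 * n * m + 8 * m\<^sup>2)"]
      infsum_split_residues[where M = 5 and lo = "-2" and a = 0 and c = 1, OF summable_on_swap_args[OF summable_on_theta_5_2_8[OF q]] zero_less_numeral]
      sum_residues5 *
    using qtheta_1_minus[of 5 2 q] qtheta_1_minus[of 5 4 q] qtheta_1_minus[of 195 78 q] qtheta_1_minus[of 195 156 q]
    by (simp add: qtheta_power)
qed

text \<open>Rests on \<open>5(5n^2 + 2nm + 8m^2) = 3(2n + 3m)^2 + 13(n - m)^2\<close>, with
  \<open>n - m\<close> sorted modulo 5.\<close>

lemma theta_5_2_8_split_13: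
  assumes q: "q \<noteq> 0" "norm q < 1"
  shows "theta_form 5 2 8 q = qtheta 1 5 0 (q ^ 3) * qtheta 1 5 0 (q ^ 13) + 2 * q ^ 5 * qtheta 1 5 4 (q ^ 3) * qtheta 1 5 2 (q ^ 13)
     + 2 * q ^ 11 * qtheta 1 5 2 (q ^ 3) * qtheta 1 5 4 (q ^ 13)"
proof -
  have *: "infsum (\<lambda>(i, j). q powi (5 * (5 * j + d + 1 * (i - 2 * j))\<^sup>2 + 2 * (5 * j + d + 1 * (i - 2 * j)) * (i - 2 * j)
      + 8 * (i - 2 * j)\<^sup>2)) UNIV = q powi (5 * d\<^sup>2) * qtheta 1 15 (12 * d) q * qtheta 1 65 (26 * d) q" for d
    by (rule infsum_qtheta_qtheta1[OF q]) (simp_all add: power2_eq_square algebra_simps)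
  have 9: "q ^ 9 * qtheta 1 15 24 q = qtheta 1 15 6 q"
    using qtheta_shift[OF q(1), of 1 15 "-6"] qtheta_1_minus[of 15 6 q] q
    by (simp_all add: power_int_minus field_simps)
  have "q ^ 20 * qtheta 1 15 24 q = q ^ 11 * (q ^ 9 * qtheta 1 15 24 q)"
    by (simp flip: mult.assoc power_add)
  then have sh: "q ^ 20 * qtheta 1 15 24 q = q ^ 11 * qtheta 1 15 6 q" unfolding 9 .
  show ?thesis
    unfolding theta_form_def
      infsum_split_residues[where M = 5 and lo = "-2" and a = 1 and c = 2, OF summable_on_theta_5_2_8[OF q] zero_less_numeral]
      sum_residues5 *
    using qtheta_1_minus[of 15 12 q] qtheta_1_minus[of 15 24 q] qtheta_1_minus[of 65 26 q] qtheta_1_minus[of 65 52 q] sh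
    by (simp add: qtheta_power)
qed

text \<open>Rests on \<open>5(n^2 + m^2) = (2n + m)^2 + (n - 2m)^2\<close>, with
  \<open>n - 2m\<close> sorted modulo 5. The zero class gives \<open>\<phi>(q^5)^2\<close>, and the
  other four classes contribute equally.\<close>

lemma ram_phi_square_diff:
  assumes q: "q \<noteq> 0" "norm q < 1"
  shows "(ram_phi q)\<^sup>2 = (ram_phi (q ^ 5))\<^sup>2 + 4 * q * qtheta 1 5 4 q * qtheta 1 5 2 q"
proof -
  have sm: "(\<lambda>(n, m). q powi (1 * n\<^sup>2 + 0 * n * m + 1 * m\<^sup>2)) summable_on UNIV"
    by (rule summable_on_theta_form[where K = 1]) (use q in auto)
  have *: "infsum (\<lambda>(i, j). q powi (1 * (5 * j + d + 2 * (i - 2 * j))\<^sup>2 + 0 * (5 * j + d + 2 * (i - 2 * j)) * (i - 2 * j)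
      + 1 * (i - 2 * j)\<^sup>2)) UNIV = q powi (d\<^sup>2) * qtheta 1 5 (4 * d) q * qtheta 1 5 (2 * d) q" for d
    by (rule infsum_qtheta_qtheta1[OF q]) (simp_all add: power2_eq_square algebra_simps)
  have 3: "q ^ 3 * qtheta 1 5 8 q = qtheta 1 5 2 q"
    using qtheta_shift[OF q(1), of 1 5 "-2"] qtheta_1_minus[of 5 2 q] q
    by (simp_all add: power_int_minus field_simps)
  have "q ^ 4 * qtheta 1 5 8 q = q * (q ^ 3 * qtheta 1 5 8 q)"
    by (simp add: eval_nat_numeral)
  then have sh: "q ^ 4 * qtheta 1 5 8 q = q * qtheta 1 5 2 q" unfolding 3 .
  have "(ram_phi q)\<^sup>2 = theta_form 1 0 1 q"
    using theta_form_diag[OF q, of 1 1] by (simp add: ram_phi_eq_qtheta power2_eq_square)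
  also have "\<dots> = (qtheta 1 5 0 q)\<^sup>2 + 4 * q * qtheta 1 5 4 q * qtheta 1 5 2 q"
    unfolding theta_form_def
      infsum_split_residues[where M = 5 and lo = "-2" and a = 2 and c = 2, OF sm zero_less_numeral]
      sum_residues5 *
    using qtheta_1_minus[of 5 2 q] qtheta_1_minus[of 5 4 q] qtheta_1_minus[of 5 8 q] sh
    by (simp add: power2_eq_square)
  finally show ?thesis by (simp add: ram_phi_eq_qtheta qtheta_power)
qed

lemma qtheta_neg_one_4_0: "qtheta (-1) 4 0 t = ram_phi (- (t ^ 4))"
  unfolding ram_phi_def qtheta_def
  by (rule infsum_cong) (auto simp: power_int_minus_left power_int_power)

text \<open>With \<open>X = 2m + 1\<close> and \<open>Y = 2k\<close> the identity behind the
  splitting is \<open>5(X^2 + 4Y^2) = (X + 4Y)^2 + 4(X - Y)^2\<close>. The classes of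
  \<open>2d + 1 = 1, -1\<close> and of \<open>3, -3\<close> give the two terms twice; the class of 5
  vanishes because of the alternating sign.\<close>

lemma rr_lattice_1_4:
  assumes t: "t \<noteq> 0" "norm t < 1"
  shows "qtheta (-1) 5 1 t * qtheta (-1) 5 1 (t ^ 4) + t\<^sup>2 * qtheta (-1) 5 3 t * qtheta (-1) 5 3 (t ^ 4)
     = ram_phi (- (t ^ 4)) * ram_psi (t\<^sup>2)"
proof -
  define f where "f m = 1 powi m * t powi (1 * m\<^sup>2 + 1 * m)" for m
  define g where "g k = (-1) powi k * t powi (4 * k\<^sup>2 + 0 * k)" for k
  have f: "f summable_on UNIV" and g: "g summable_on UNIV"
    unfolding f_def g_def by (rule summable_on_qtheta; use t in simp)+
  have *: "infsum (\<lambda>(i, j). f (5 * j + d + 1 * (i - 1 * j)) * g (i - 1 * j)) UNIV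
     = t powi (d\<^sup>2 + d) * qtheta (-1) 5 (2 * d + 1) t * qtheta (-1) 20 (4 * (2 * d + 1)) t" for d
  proof (rule infsum_qtheta_qtheta[OF t])
    fix i j :: int
    have "f (5 * j + d + 1 * (i - 1 * j)) * g (i - 1 * j)
       = (-1) powi (i - j) * (t powi ((5 * j + d + (i - j))\<^sup>2 + (5 * j + d + (i - j))) * t powi (4 * (i - j)\<^sup>2))"
      by (simp add: f_def g_def)
    also have "(-1 :: complex) powi (i - j) = (-1) powi i * (-1) powi j"
      by (rule sign_powi_diff) simp
    also have "t powi ((5 * j + d + (i - j))\<^sup>2 + (5 * j + d + (i - j))) * t powi (4 * (i - j)\<^sup>2)
       = t powi ((5 * j + d + (i - j))\<^sup>2 + (5 * j + d + (i - j)) + 4 * (i - j)\<^sup>2)"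
      using t by (simp only: power_int_add simp_thms)
    finally show "f (5 * j + d + 1 * (i - 1 * j)) * g (i - 1 * j) = (-1) powi i * (-1) powi j *
      t powi ((5 * j + d + (i - j))\<^sup>2 + (5 * j + d + (i - j)) + 4 * (i - j)\<^sup>2)" .
  qed (simp_all add: power2_eq_square algebra_simps)
  have "2 * (ram_phi (- (t ^ 4)) * ram_psi (t\<^sup>2)) = infsum f UNIV * infsum g UNIV"
    using qtheta_1_1_1[OF t] qtheta_neg_one_4_0[of t] by (simp add: f_def[abs_def] g_def[abs_def] qtheta_def)
  also have "\<dots> = infsum (\<lambda>(m, k). f m * g k) UNIV"
    by (rule infsum_prod_mult[OF f g, symmetric])
  also have "\<dots> = 2 * (qtheta (-1) 5 1 t * qtheta (-1) 5 1 (t ^ 4) + t\<^sup>2 * qtheta (-1) 5 3 t * qtheta (-1) 5 3 (t ^ 4))"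
    unfolding infsum_split_residues[where M = 5 and lo = "-2" and a = 1 and c = 1, OF summable_on_prod_mult[OF f g] zero_less_numeral]
      sum_residues5 *
    using qtheta_minus[of "-1" 5 1 t] qtheta_minus[of "-1" 5 3 t] qtheta_minus[of "-1" 20 4 t] qtheta_minus[of "-1" 20 12 t]
      qtheta_neg_one_diag[OF t(1), of 5]
    by (simp add: qtheta_power algebra_simps)
  finally have "ram_phi (- (t ^ 4)) * ram_psi (t\<^sup>2)
     = qtheta (-1) 5 1 t * qtheta (-1) 5 1 (t ^ 4) + t\<^sup>2 * qtheta (-1) 5 3 t * qtheta (-1) 5 3 (t ^ 4)"
    by (rule mult_left_cancel[THEN iffD1, rotated]) simp
  then show ?thesis by (rule sym)
qed

section \<open>Continuity of theta functions on the disc\<close>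

lemma qtheta_exponent_ge:
  fixes a b n :: int
  assumes "\<bar>b\<bar> < a"
  shows "\<bar>n\<bar> \<le> a * n\<^sup>2 + b * n"
proof -
  have "a * \<bar>n\<bar> \<le> a * n\<^sup>2" using assms abs_le_square_int[of n] by (intro mult_left_mono) auto
  moreover have "- (b * n) \<le> (a - 1) * \<bar>n\<bar>"
  proof -
    have "- (b * n) \<le> \<bar>b\<bar> * \<bar>n\<bar>" by (metis abs_ge_minus_self abs_mult)
    also have "\<dots> \<le> (a - 1) * \<bar>n\<bar>" using assms by (intro mult_right_mono) auto
    finally show ?thesis .
  qed
  ultimately show ?thesis by (simp add: algebra_simps)
qed

text \<open>For \<open>|b| < a\<close> the exponent is at least \<open>|n|\<close>, hence never
  negative; near \<open>t\<close> all terms are dominated by \<open>r^|n|\<close>, and the origin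
  needs no exception.\<close>

lemma continuous_on_qtheta:
  assumes e: "e = 1 \<or> e = -1" and ab: "\<bar>b\<bar> < a"
  shows "continuous_on (ball 0 1) (qtheta e a b)"
proof (rule continuous_at_imp_continuous_on, rule ballI)
  fix t :: complex assume "t \<in> ball 0 1"
  then have t: "norm t < 1" by simp
  then obtain r where r: "norm t < r" "r < 1" using dense by blast
  have r0: "0 \<le> r" using r norm_ge_zero[of t] by linarith
  have ex: "s powi (a * n\<^sup>2 + b * n) = s ^ nat (a * n\<^sup>2 + b * n)" for s :: complex and n
    using qtheta_exponent_ge[OF ab, of n] by (intro power_int_nonneg_exp) linarith
  have "((\<lambda>s. infsum (\<lambda>n. e powi n * s powi (a * n\<^sup>2 + b * n)) UNIV) \<longlongrightarrow>
      infsum (\<lambda>n. e powi n * t powi (a * n\<^sup>2 + b * n)) UNIV) (at t)"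
  proof (rule infsum_tendsto_dominated)
    show "((\<lambda>s. e powi n * s powi (a * n\<^sup>2 + b * n)) \<longlongrightarrow> e powi n * t powi (a * n\<^sup>2 + b * n)) (at t)" for n
      unfolding ex by (intro tendsto_intros)
    show "(\<lambda>n::int. r ^ nat \<bar>n\<bar>) summable_on UNIV" by (rule summable_on_geometric_int[OF r0 r(2)])
    have "eventually (\<lambda>s. norm s < r) (at t)"
      by (rule order_tendstoD(2)[OF tendsto_norm[OF tendsto_ident_at] r(1)])
    then show "\<forall>\<^sub>F s in at t. \<forall>n. norm (e powi n * s powi (a * n\<^sup>2 + b * n)) \<le> r ^ nat \<bar>n\<bar>"
    proof eventually_elim
      case (elim s)
      show ?case
      proof
        fix n :: int
        have "norm (e powi n * s powi (a * n\<^sup>2 + b * n)) \<le> norm s ^ nat (a * n\<^sup>2 + b * n)"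
          unfolding ex norm_mult norm_power using norm_sign_powi_le[OF e, of n] by (intro mult_left_le_one_le) auto
        also have "\<dots> \<le> r ^ nat (a * n\<^sup>2 + b * n)" using elim by (intro power_mono) auto
        also have "\<dots> \<le> r ^ nat \<bar>n\<bar>"
          using qtheta_exponent_ge[OF ab, of n] r r0 by (intro power_decreasing nat_mono) auto
        finally show "norm (e powi n * s powi (a * n\<^sup>2 + b * n)) \<le> r ^ nat \<bar>n\<bar>" .
      qed
    qed
  qed
  then show "isCont (qtheta e a b) t" by (simp add: isCont_def qtheta_def[abs_def])
qed

lemma qtheta_at_0:
  assumes "\<bar>b\<bar> < a"
  shows "qtheta e a b 0 = 1"
proof -
  have "qtheta e a b 0 = infsum (\<lambda>n. e powi n * 0 powi (a * n\<^sup>2 + b * n)) {0}"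
    unfolding qtheta_def
  proof (rule infsum_cong_neutral)
    fix n :: int assume "n \<in> UNIV - {0}"
    then have "0 < a * n\<^sup>2 + b * n" using qtheta_exponent_ge[OF assms, of n] by auto
    then show "e powi n * 0 powi (a * n\<^sup>2 + b * n) = 0" by simp
  qed auto
  then show ?thesis by simp
qed

subsection \<open>Two-term identities for the Rogers-Ramanujan functions\<close>

lemma ram_phi_nonzero:
  assumes q: "q \<noteq> 0" "norm q < 1"
  shows "ram_phi q \<noteq> 0"
  using ram_phi_euler_E[OF q] euler_E_nonzero[of "- q"] q by auto

lemma ram_psi_nonzero:
  assumes q: "q \<noteq> 0" "norm q < 1"
  shows "ram_psi q \<noteq> 0"
  using ram_psi_euler_E[OF q] euler_E_nonzero[of "- q"] euler_E_nonzero[of "q ^ 4"] norm_power_less_one[OF q(2), of 4] q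
  by auto

text \<open>Both sides are \<open>E(q) E(-q)^2 E(q^4) / E(q^2)^2\<close>. This exposes the factor
  \<open>\<psi>(-q) = E(q) E(q^4) / E(q^2)\<close> in the lattice identity for
  \<open>G(q)G(q^4)\<close>.\<close>

lemma ram_phi_ram_psi_minus:
  assumes q: "q \<noteq> 0" "norm q < 1"
  shows "ram_phi (- (q\<^sup>2)) * ram_psi q = ram_phi q * ram_psi (- q)"
proof -
  have nz: "euler_E (q\<^sup>2) \<noteq> 0" using euler_E_nonzero norm_power_less_one[OF q(2), of 2] by simp
  have "(ram_phi (- (q\<^sup>2)) * euler_E (q\<^sup>2)) * (ram_psi q * euler_E (q\<^sup>2))
      = (ram_phi q * euler_E (q\<^sup>2)) * (ram_psi (- q) * euler_E (q\<^sup>2))"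
    unfolding ram_phi_minus_euler_E[OF q] ram_psi_euler_E[OF q] ram_phi_euler_E[OF q] ram_psi_minus_euler_E[OF q]
    by (simp add: power2_eq_square)
  with nz show ?thesis by simp
qed

lemma rr_1_4_sum:
  assumes q: "q \<noteq> 0" "norm q < 1"
  shows "euler_E (q\<^sup>2) * (rr_G q * rr_G (q ^ 4) + q * rr_H q * rr_H (q ^ 4)) = ram_phi q"
proof -
  define t where "t = csqrt q"
  have tq: "t\<^sup>2 = q" by (simp add: t_def)
  then have t: "t \<noteq> 0" "norm t < 1"
    using q by (auto simp: norm_power power_less_one_iff)
  have t4: "t ^ 4 \<noteq> 0" "norm (t ^ 4) < 1" using t norm_power_less_one[of t 4] by auto
  have pw: "t ^ 4 = q\<^sup>2" "(t ^ 4)\<^sup>2 = q ^ 4" unfolding tq[symmetric] by (simp_all add: power_mult[symmetric])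
  have "(euler_E q * rr_G q) * (euler_E (q ^ 4) * rr_G (q ^ 4)) + q * (euler_E q * rr_H q) * (euler_E (q ^ 4) * rr_H (q ^ 4))
      = ram_phi q * ram_psi (- q)"
    using rr_lattice_1_4[OF t] rogers_ramanujan[OF t] rogers_ramanujan[OF t4] ram_phi_ram_psi_minus[OF q]
    unfolding tq pw by simp
  then have "(euler_E q * euler_E (q ^ 4)) * (rr_G q * rr_G (q ^ 4) + q * rr_H q * rr_H (q ^ 4)) = ram_phi q * ram_psi (- q)"
    by (simp add: algebra_simps)
  then show ?thesis
    unfolding ram_psi_minus_euler_E[OF q, symmetric] using ram_psi_nonzero[of "- q"] q by simp
qed

text \<open>In \<open>(x - y)^2 = (x + y)^2 - 4xy\<close> the product \<open>xy\<close> regroups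
  into \<open>G(q)H(q^4)\<close> and \<open>H(q)G(q^4)\<close>, each a single theta
  function.\<close>

lemma rr_1_4_diff_square:
  assumes q: "q \<noteq> 0" "norm q < 1"
  shows "(euler_E (q\<^sup>2) * (rr_G q * rr_G (q ^ 4) - q * rr_H q * rr_H (q ^ 4)))\<^sup>2 = (ram_phi (q ^ 5))\<^sup>2"
proof -
  have alg: "(E * (a * b - x * c * d))\<^sup>2 = (E * (a * b + x * c * d))\<^sup>2 - 4 * x * (E * a * d) * (E * c * b)"
    for E a b c d x :: complex by algebra
  show ?thesis
    unfolding alg rr_1_4_sum[OF q] rr_product_theta(3,4)[OF q] ram_phi_square_diff[OF q] by simp
qed

lemma continuous_on_qtheta_power:
  assumes "e = 1 \<or> e = -1" "\<bar>b\<bar> < a" "0 < n" "s = 1 \<or> s = -1"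
  shows "continuous_on (ball 0 1) (\<lambda>t. qtheta e a b (s * t ^ n))"
proof (rule continuous_on_compose2[OF continuous_on_qtheta[OF assms(1,2)]])
  have "norm (s * t ^ n) < 1" if "norm t < 1" for t :: complex
    using assms norm_power_less_one[OF that] by auto
  then show "(\<lambda>t. s * t ^ n) ` ball 0 1 \<subseteq> ball 0 1" by auto
qed (intro continuous_intros)

text \<open>The squares of both sides agree; the sign is the same on the whole disc by connectedness,
  and it is positive at the origin.\<close>

lemma rr_1_4_diff:
  assumes q: "q \<noteq> 0" "norm q < 1"
  shows "euler_E (q\<^sup>2) * (rr_G q * rr_G (q ^ 4) - q * rr_H q * rr_H (q ^ 4)) = ram_phi (q ^ 5)"
proof -
  \<comment> \<open>\<open>L\<close> and \<open>M\<close> are the two sides at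
    \<open>q = t^2\<close> multiplied by \<open>\<psi>(-q)\<close>. In this form they are
    polynomials in \<open>t\<close> and theta functions, continuous on the whole disc with value 1
    at the origin, and no branch of the square root enters.\<close>
  define L where "L t = qtheta (-1) 5 1 (1 * t ^ 1) * qtheta (-1) 5 1 (1 * t ^ 4)
     - t\<^sup>2 * qtheta (-1) 5 3 (1 * t ^ 1) * qtheta (-1) 5 3 (1 * t ^ 4)" for t
  define M where "M t = qtheta 1 2 1 (-1 * t\<^sup>2) * qtheta 1 1 0 (1 * t ^ 10)" for t :: complex
  have L: "L t = ram_psi (- (t\<^sup>2)) * (euler_E ((t\<^sup>2)\<^sup>2) * (rr_G (t\<^sup>2) * rr_G ((t\<^sup>2) ^ 4) - t\<^sup>2 * rr_H (t\<^sup>2) * rr_H ((t\<^sup>2) ^ 4)))"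
    and M: "M t = ram_psi (- (t\<^sup>2)) * ram_phi ((t\<^sup>2) ^ 5)"
    and LM: "(L t)\<^sup>2 = (M t)\<^sup>2" and M0: "M t \<noteq> 0"
    if t: "t \<noteq> 0" "norm t < 1" for t
  proof -
    have t2: "t\<^sup>2 \<noteq> 0" "norm (t\<^sup>2) < 1" using t norm_power_less_one[of t 2] by auto
    have t4: "t ^ 4 \<noteq> 0" "norm (t ^ 4) < 1" using t norm_power_less_one[of t 4] by auto
    have t10: "(t\<^sup>2) ^ 5 \<noteq> 0" "norm ((t\<^sup>2) ^ 5) < 1" using t2 norm_power_less_one[of "t\<^sup>2" 5] by auto
    have pw: "(t ^ 4)\<^sup>2 = (t\<^sup>2) ^ 4" "t ^ 10 = (t\<^sup>2) ^ 5" by (simp_all add: power_mult[symmetric])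
    have "L t = (euler_E (t\<^sup>2) * rr_G (t\<^sup>2)) * (euler_E ((t\<^sup>2) ^ 4) * rr_G ((t\<^sup>2) ^ 4))
        - t\<^sup>2 * (euler_E (t\<^sup>2) * rr_H (t\<^sup>2)) * (euler_E ((t\<^sup>2) ^ 4) * rr_H ((t\<^sup>2) ^ 4))"
      unfolding L_def using rogers_ramanujan[OF t] rogers_ramanujan[OF t4, unfolded pw] by simp
    also have "\<dots> = (euler_E (t\<^sup>2) * euler_E ((t\<^sup>2) ^ 4)) * (rr_G (t\<^sup>2) * rr_G ((t\<^sup>2) ^ 4) - t\<^sup>2 * rr_H (t\<^sup>2) * rr_H ((t\<^sup>2) ^ 4))"
      by algebra
    also have "\<dots> = ram_psi (- (t\<^sup>2)) * (euler_E ((t\<^sup>2)\<^sup>2) * (rr_G (t\<^sup>2) * rr_G ((t\<^sup>2) ^ 4) - t\<^sup>2 * rr_H (t\<^sup>2) * rr_H ((t\<^sup>2) ^ 4)))"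
      unfolding ram_psi_minus_euler_E[OF t2, symmetric] by (simp only: mult.assoc)
    finally show 1: "L t = \<dots>" .
    show 2: "M t = ram_psi (- (t\<^sup>2)) * ram_phi ((t\<^sup>2) ^ 5)"
      unfolding M_def using ram_psi_eq_qtheta[of "- (t\<^sup>2)"] t2 by (simp only: pw ram_phi_eq_qtheta mult_minus1 mult_1 norm_minus_cancel)
    show "(L t)\<^sup>2 = (M t)\<^sup>2"
      unfolding 1 2 power_mult_distrib[of "ram_psi (- (t\<^sup>2))"] rr_1_4_diff_square[OF t2] ..
    show "M t \<noteq> 0"
      unfolding 2 using ram_psi_nonzero[of "- (t\<^sup>2)"] ram_phi_nonzero[OF t10] t2 by simp
  qed
  have L0: "L 0 = 1" and M00: "M 0 = 1" by (simp_all add: L_def M_def qtheta_at_0)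
  have LM': "(L t)\<^sup>2 = (M t)\<^sup>2" and M0': "M t \<noteq> 0" if "t \<in> ball 0 1" for t
    using LM[of t] M0[of t] L0 M00 that by (cases "t = 0"; simp)+
  have cont: "continuous_on (ball 0 1) (\<lambda>t. L t / M t)"
    unfolding L_def M_def
    using M0'[unfolded M_def]
    by (intro continuous_intros continuous_on_qtheta_power) auto
  have "finite ((\<lambda>t. L t / M t) ` ball 0 1)"
  proof (rule finite_subset[of _ "{1, -1}"])
    have "L t / M t = 1 \<or> L t / M t = -1" if "t \<in> ball 0 1" for t
      using LM'[OF that] M0'[OF that] by (auto simp: power2_eq_iff)
    then show "(\<lambda>t. L t / M t) ` ball 0 1 \<subseteq> {1, -1}" by blast
  qed simp
  with cont have "(\<lambda>t. L t / M t) constant_on ball 0 1"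
    by (intro continuous_finite_range_constant) auto
  then have const: "L t / M t = L 0 / M 0" if "t \<in> ball 0 1" for t
    using that unfolding constant_on_def by (metis centre_in_ball zero_less_one)
  define t where "t = csqrt q"
  have tq: "t\<^sup>2 = q" by (simp add: t_def)
  then have t: "t \<noteq> 0" "norm t < 1"
    using q by (auto simp: norm_power power_less_one_iff)
  have "L t = M t" using const[of t] M0[OF t] t by (simp add: L0 M00)
  then show ?thesis
    unfolding L[OF t] M[OF t] tq using ram_psi_nonzero[of "- q"] q by simp
qed

lemma rr_G_rr_G_4:
  assumes q: "q \<noteq> 0" "norm q < 1"
  shows "euler_E (q\<^sup>2) * rr_G q * rr_G (q ^ 4) = (ram_phi q + ram_phi (q ^ 5)) / 2"
    and "q * euler_E (q\<^sup>2) * rr_H q * rr_H (q ^ 4) = (ram_phi q - ram_phi (q ^ 5)) / 2"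
  unfolding rr_1_4_sum[OF q, symmetric] rr_1_4_diff[OF q, symmetric] by (simp_all add: field_simps)

lemma rr_H_nonzero:
  assumes q: "q \<noteq> 0" "norm q < 1"
  shows "rr_H q \<noteq> 0"
  using rr_product(2)[OF q] qpoch_inf_power_nonzero(1)[OF q(2), of 5 2] qpoch_inf_power_nonzero(1)[OF q(2), of 5 3]
  by simp

lemma ram_phi_parity:
  assumes q: "q \<noteq> 0" "norm q < 1"
  shows "ram_phi q = ram_phi (q ^ 4) + 2 * q * ram_psi (q ^ 8)"
proof -
  have q4: "q ^ 4 \<noteq> 0" "norm (q ^ 4) < 1" using q norm_power_less_one[of q 4] by auto
  have "qtheta 1 4 4 q = 2 * ram_psi (q ^ 8)"
    using qtheta_1_1_1[OF q4] by (simp add: qtheta_power power_mult[symmetric])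
  then show ?thesis
    using qtheta_parity_split[OF q, of 1 0] by (simp add: ram_phi_eq_qtheta qtheta_power)
qed

text \<open>For \<open>s^4 = q\<close> the even and odd parts of the theta function of
  \<open>G(s)H(s^4)\<close> are those of \<open>H(q)G(q^4)\<close> and \<open>H(q)H(-q)\<close>.
  Cancelling \<open>H(q)\<close> and multiplying by \<open>G(q)\<close> expresses
  \<open>G(q)H(-q)\<close> through \<open>G(s)G(s^4)\<close> and \<open>G(q)G(q^4)\<close>, both
  known; splitting \<open>\<phi>\<close> by parity leaves the values of
  \<open>\<psi>\<close>.\<close>

lemma rr_G_rr_H_minus:
  assumes q: "q \<noteq> 0" "norm q < 1"
  shows "euler_E (q\<^sup>2) * rr_G q * rr_H (- q) = ram_psi (q\<^sup>2) + q * ram_psi (q ^ 10)"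
proof -
  define s where "s = csqrt (csqrt q)"
  have sq: "s ^ 4 = q"
  proof -
    have "s ^ 4 = (s\<^sup>2)\<^sup>2" by (simp add: power_mult[symmetric])
    then show ?thesis by (simp add: s_def)
  qed
  then have s: "s \<noteq> 0" "norm s < 1"
    using q by (auto simp: norm_power power_less_one_iff)
  have s5: "s ^ 5 \<noteq> 0" "norm (s ^ 5) < 1" using s norm_power_less_one[of s 5] by auto
  have pw: "s ^ 8 = q\<^sup>2" "(s ^ 5) ^ 4 = q ^ 5" "(s ^ 5) ^ 8 = q ^ 10" "s ^ 5 = s * q"
    unfolding sq[symmetric] by (simp_all add: power_mult[symmetric]) (simp add: eval_nat_numeral)
  have "qtheta 1 5 4 s = qtheta 1 20 8 s + s * qtheta 1 20 12 s"
  proof -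
    have "qtheta 1 20 28 s = s powi (- 8) * qtheta 1 20 12 s"
      using qtheta_shift[OF s(1), of 1 20 "-12"] qtheta_1_minus[of 20 12 s] by simp
    moreover have "s powi 9 * s powi (- 8) = s" using s by (simp only: power_int_add[symmetric] simp_thms) simp
    ultimately show ?thesis using qtheta_parity_split[OF s, of 5 4] by (simp flip: mult.assoc)
  qed
  also have "qtheta 1 20 8 s = qtheta 1 5 2 q"
    unfolding sq[symmetric] qtheta_power by simp
  also have "qtheta 1 20 12 s = qtheta 1 5 3 q"
    unfolding sq[symmetric] qtheta_power by simp
  finally have "euler_E (s\<^sup>2) * rr_G s * rr_H q
      = euler_E (q\<^sup>2) * rr_H q * rr_G (q ^ 4) + s * (euler_E (q\<^sup>2) * rr_H q * rr_H (- q))"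
    using rr_product_theta(3)[OF s] rr_product_theta(2,4)[OF q] by (simp add: sq)
  then have "rr_H q * (euler_E (s\<^sup>2) * rr_G s) = rr_H q * (euler_E (q\<^sup>2) * rr_G (q ^ 4) + s * (euler_E (q\<^sup>2) * rr_H (- q)))"
    by (simp add: algebra_simps)
  then have 1: "euler_E (s\<^sup>2) * rr_G s = euler_E (q\<^sup>2) * rr_G (q ^ 4) + s * (euler_E (q\<^sup>2) * rr_H (- q))"
    using rr_H_nonzero[OF q] by simp
  have "s * (euler_E (q\<^sup>2) * rr_G q * rr_H (- q)) = euler_E (s\<^sup>2) * rr_G s * rr_G q - euler_E (q\<^sup>2) * rr_G q * rr_G (q ^ 4)"
    unfolding 1 by (simp add: algebra_simps)
  also have "\<dots> = (ram_phi s + ram_phi (s ^ 5)) / 2 - (ram_phi q + ram_phi (q ^ 5)) / 2"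
    unfolding rr_G_rr_G_4(1)[OF s, unfolded sq] rr_G_rr_G_4(1)[OF q] ..
  also have "\<dots> = s * (ram_psi (q\<^sup>2) + q * ram_psi (q ^ 10))"
    unfolding ram_phi_parity[OF s] ram_phi_parity[OF s5] pw(1-3) sq by (simp add: pw(4) field_simps)
  finally show ?thesis using s by simp
qed

lemma rr_G_minus_rr_H:
  assumes q: "q \<noteq> 0" "norm q < 1"
  shows "euler_E (q\<^sup>2) * rr_G (- q) * rr_H q = ram_psi (q\<^sup>2) - q * ram_psi (q ^ 10)"
  using rr_G_rr_H_minus[of "- q"] q by simp

subsection \<open>The functions \<open>U(1,39)\<close> and \<open>U(3,13)\<close>\<close>

lemma rr_U_1_39: "rr_U 1 39 q = rr_G q * rr_G (q ^ 39) + q ^ 8 * rr_H q * rr_H (q ^ 39)"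
  by (simp add: rr_U_def)

lemma rr_U_3_13: "rr_U 3 13 q = rr_H (q ^ 3) * rr_G (q ^ 13) - q ^ 2 * rr_G (q ^ 3) * rr_H (q ^ 13)"
  by (simp add: rr_U_def)

text \<open>Both sides equal \<open>form39 (-1) t / (2q)\<close> with \<open>t\<^sup>2 = q\<close>.\<close>

lemma rr_U_1_39_eq_rr_U_3_13:
  assumes q: "q \<noteq> 0" "norm q < 1"
  shows "euler_E q * euler_E (q ^ 39) * rr_U 1 39 q = euler_E (q ^ 3) * euler_E (q ^ 13) * rr_U 3 13 q"
proof -
  define t where "t = csqrt q"
  have tq: "t\<^sup>2 = q" by (simp add: t_def)
  then have t: "t \<noteq> 0" "norm t < 1"
    using q by (auto simp: norm_power power_less_one_iff)
  have tn: "t ^ n \<noteq> 0" "norm (t ^ n) < 1" if "0 < n" for n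
    using t norm_power_less_one[OF t(2) that] by auto
  have rr: "qtheta (-1) 5 1 (t ^ n) = euler_E (q ^ n) * rr_G (q ^ n)" "qtheta (-1) 5 3 (t ^ n) = euler_E (q ^ n) * rr_H (q ^ n)"
    if "0 < n" for n
    using rogers_ramanujan[OF tn[OF that]] unfolding tq[symmetric] by (simp_all add: power_mult[symmetric] mult.commute)
  have pw: "t ^ 18 = q * q ^ 8" "t ^ 6 = q * q ^ 2"
    unfolding tq[symmetric] by (simp_all add: power_mult[symmetric] flip: power_add)
  \<comment> \<open>In both splittings the class of 5 modulo 10 vanishes for the sign -1, so exactly
    the two terms of U survive.\<close>
  have "2 * q * (euler_E q * euler_E (q ^ 39) * rr_U 1 39 q) = form39 (-1) t"
    using form39_split_39[OF t, of "-1"] qtheta_neg_one_diag[OF t(1), of 5] rr[of 1] rr[of 39]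
    unfolding rr_U_1_39 pw tq by (simp add: algebra_simps)
  moreover have "2 * q * (euler_E (q ^ 3) * euler_E (q ^ 13) * rr_U 3 13 q) = form39 (-1) t"
    using form39_split_13[OF t, of "-1"] qtheta_neg_one_diag[OF tn(1), of 3 5] rr[of 3] rr[of 13]
    unfolding rr_U_3_13 pw tq by (simp add: algebra_simps)
  ultimately have "2 * q * (euler_E q * euler_E (q ^ 39) * rr_U 1 39 q)
      = 2 * q * (euler_E (q ^ 3) * euler_E (q ^ 13) * rr_U 3 13 q)" by (rule trans[OF _ sym])
  then show ?thesis using q by (metis mult_left_cancel no_zero_divisors zero_neq_numeral)
qed

section \<open>Products of two values of U as theta series of binary forms\<close>

lemma qtheta_1_5_5:
  assumes q: "q \<noteq> 0" "norm q < 1"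
  shows "qtheta 1 5 5 q = 2 * ram_psi (q ^ 10)"
proof -
  have "q ^ 5 \<noteq> 0" "norm (q ^ 5) < 1" using q norm_power_less_one[of q 5] by auto
  from qtheta_1_1_1[OF this] show ?thesis by (simp add: qtheta_power power_mult[symmetric])
qed

text \<open>The GG and HH terms supply the classes of 1 and 3 in \<open>form39 1 q\<close>. In the
  cross terms the mixed products of \<open>\<psi>\<close> cancel: one survivor is the class of 5,
  since \<open>q^50 = q^10 q q^39\<close>, and the other is (1,1,10) - (1,0,39).\<close>

lemma rr_U_1_39_minus:
  assumes q: "q \<noteq> 0" "norm q < 1"
  shows "2 * q ^ 2 * euler_E (q ^ 2) * euler_E (q ^ 78) * rr_U 1 39 q * rr_U 1 39 (- q)
    = theta_form 1 1 10 q + theta_form 2 1 5 q - theta_form 1 0 39 q - theta_form 5 2 8 q"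
proof -
  define p where "p = q ^ 39"
  have p: "p \<noteq> 0" "norm p < 1" using q norm_power_less_one[of q 39] by (auto simp: p_def)
  have p2: "p\<^sup>2 = q ^ 78" "(- q) ^ 39 = - p" "p ^ 10 = q ^ 390" by (simp_all add: p_def power_mult[symmetric])
  have m8: "(- q) ^ 8 = q ^ 8" by simp
  have alg: "2 * q ^ 2 * E * E' * (g * G + q ^ 8 * h * H) * (g' * G' + q ^ 8 * h' * H')
     = 2 * q ^ 2 * (E * g * g') * (E' * G * G') + 2 * q ^ 18 * (E * h * h') * (E' * H * H')
      + 2 * q ^ 10 * ((E * g * h') * (E' * G * H') + (E * g' * h) * (E' * G' * H))"
    for E E' g G h H g' G' h' H' :: complex
    by algebra
  have "2 * q ^ 2 * euler_E (q ^ 2) * euler_E (q ^ 78) * rr_U 1 39 q * rr_U 1 39 (- q)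
     = 2 * q ^ 2 * qtheta 1 5 1 q * qtheta 1 5 1 p + 2 * q ^ 18 * qtheta 1 5 3 q * qtheta 1 5 3 p
      + 2 * q ^ 10 * ((ram_psi (q\<^sup>2) + q * ram_psi (q ^ 10)) * (ram_psi (p\<^sup>2) + p * ram_psi (p ^ 10))
        + (ram_psi (q\<^sup>2) - q * ram_psi (q ^ 10)) * (ram_psi (p\<^sup>2) - p * ram_psi (p ^ 10)))"
    unfolding rr_U_1_39 p2(2) p_def[symmetric] p2(1)[symmetric] m8
      alg rr_product_theta[OF q] rr_product_theta[OF p] rr_G_rr_H_minus[OF q] rr_G_rr_H_minus[OF p]
      rr_G_minus_rr_H[OF q] rr_G_minus_rr_H[OF p] ..
  also have "\<dots> = form39 1 q + 4 * q ^ 10 * ram_psi (q\<^sup>2) * ram_psi (p\<^sup>2)"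
  proof -
    have "q ^ 50 = q ^ 10 * q * p" by (simp add: p_def flip: power_add power_Suc power_Suc2)
    then show ?thesis
      using form39_split_39[OF q, of 1] qtheta_1_5_5[OF q] qtheta_1_5_5[OF p]
      by (simp add: p_def[symmetric] algebra_simps)
  qed
  also have "\<dots> = theta_form 1 1 10 q + theta_form 2 1 5 q - theta_form 1 0 39 q - theta_form 5 2 8 q"
    using theta_form_half[OF q, of 1 39 10] theta_2_1_5_diff[OF q] qtheta_1_1_1[OF q] qtheta_1_1_1[OF p]
    by (simp add: p_def qtheta_power)
  finally show ?thesis .
qed

text \<open>As for U(1,39), but the negative sign inside U leaves the class of 5 with a plus sign,
  from \<open>q^20 = q^4 q^3 q^13\<close>, and the other survivor with a minus sign as (3,0,13) -
  (3,3,4).\<close>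

lemma rr_U_3_13_minus:
  assumes q: "q \<noteq> 0" "norm q < 1"
  shows "2 * q ^ 2 * euler_E (q ^ 6) * euler_E (q ^ 26) * rr_U 3 13 q * rr_U 3 13 (- q)
    = theta_form 3 0 13 q + theta_form 2 1 5 q - theta_form 3 3 4 q - theta_form 5 2 8 q"
proof -
  define r where "r = q ^ 3"
  define p where "p = q ^ 13"
  have p: "p \<noteq> 0" "norm p < 1" using q norm_power_less_one[of q 13] by (auto simp: p_def)
  have r: "r \<noteq> 0" "norm r < 1" using q norm_power_less_one[of q 3] by (auto simp: r_def)
  have p2: "p\<^sup>2 = q ^ 26" "(- q) ^ 13 = - p" "r\<^sup>2 = q ^ 6" "(- q) ^ 3 = - r"
    by (simp_all add: p_def r_def power_mult[symmetric])
  have alg: "2 * q ^ 2 * E * E' * (h * G - q ^ 2 * g * H) * (h' * G' - q ^ 2 * g' * H')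
     = 2 * q ^ 2 * (E * h * h') * (E' * G * G') + 2 * q ^ 6 * (E * g * g') * (E' * H * H')
      - 2 * q ^ 4 * ((E * g * h') * (E' * G' * H) + (E * g' * h) * (E' * G * H'))"
    for E E' g G h H g' G' h' H' :: complex
    by algebra
  have "2 * q ^ 2 * euler_E (q ^ 6) * euler_E (q ^ 26) * rr_U 3 13 q * rr_U 3 13 (- q)
     = 2 * q ^ 2 * qtheta 1 5 3 r * qtheta 1 5 1 p + 2 * q ^ 6 * qtheta 1 5 1 r * qtheta 1 5 3 p
      - 2 * q ^ 4 * ((ram_psi (r\<^sup>2) + r * ram_psi (r ^ 10)) * (ram_psi (p\<^sup>2) - p * ram_psi (p ^ 10))
        + (ram_psi (r\<^sup>2) - r * ram_psi (r ^ 10)) * (ram_psi (p\<^sup>2) + p * ram_psi (p ^ 10)))"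
    unfolding rr_U_3_13 p2(2,4) p_def[symmetric] r_def[symmetric] p2(1,3)[symmetric] power2_minus
      alg rr_product_theta[OF r] rr_product_theta[OF p] rr_G_rr_H_minus[OF r] rr_G_rr_H_minus[OF p]
      rr_G_minus_rr_H[OF r] rr_G_minus_rr_H[OF p] ..
  also have "\<dots> = form39 1 q - 4 * q ^ 4 * ram_psi (r\<^sup>2) * ram_psi (p\<^sup>2)"
  proof -
    have "q ^ 20 = q ^ 4 * r * p" by (simp add: p_def r_def flip: power_add)
    then show ?thesis
      using form39_split_13[OF q, of 1] qtheta_1_5_5[OF r] qtheta_1_5_5[OF p]
      by (simp add: p_def[symmetric] r_def[symmetric] algebra_simps)
  qed
  also have "\<dots> = theta_form 3 0 13 q + theta_form 2 1 5 q - theta_form 3 3 4 q - theta_form 5 2 8 q"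
    using theta_form_half[OF q, of 3 13 4] theta_2_1_5_diff[OF q] qtheta_1_1_1[OF r] qtheta_1_1_1[OF p]
    by (simp add: p_def r_def qtheta_power)
  finally show ?thesis .
qed

text \<open>The HH term carries \<open>q^40 = q q^39\<close>, exactly the factors required by
  \<open>H(q)H(q^4)\<close> at \<open>q\<close> and at \<open>q^39\<close>. Sums and differences of
  \<open>\<phi>\<close> then combine so that mixed products cancel, and the remaining terms assemble
  (5,2,8).\<close>

lemma rr_U_1_39_4:
  assumes q: "q \<noteq> 0" "norm q < 1"
  shows "2 * euler_E (q ^ 2) * euler_E (q ^ 78) * rr_U 1 39 q * rr_U 1 39 (q ^ 4)
    = theta_form 1 0 39 q + theta_form 5 2 8 q"
proof -
  define p where "p = q ^ 39"
  have p: "p \<noteq> 0" "norm p < 1" using q norm_power_less_one[of q 39] by (auto simp: p_def)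
  have p2: "p\<^sup>2 = q ^ 78" "(q ^ 4) ^ 39 = p ^ 4" "(q ^ 4) ^ 8 = q ^ 32" by (simp_all add: p_def power_mult[symmetric])
  have p40: "q ^ 40 = q * p" by (simp add: p_def flip: power_Suc)
  have alg: "2 * E * E' * (g * G + q ^ 8 * h * H) * (g' * G' + q ^ 32 * h' * H')
     = 2 * (E * g * g') * (E' * G * G') + 2 * (q ^ 40 * (E * h * h') * (E' * H * H'))
      + 2 * q ^ 8 * (E * h * g') * (E' * H * G') + 2 * q ^ 32 * (E * g * h') * (E' * G * H')"
    for E E' g G h H g' G' h' H' :: complex
    by algebra
  have alg2: "q * p * (E * h * h') * (E' * H * H') = (q * E * h * h') * (p * E' * H * H')"
    for E E' h H h' H' :: complex by algebra
  have "2 * euler_E (q ^ 2) * euler_E (q ^ 78) * rr_U 1 39 q * rr_U 1 39 (q ^ 4)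
     = 2 * ((ram_phi q + ram_phi (q ^ 5)) / 2) * ((ram_phi p + ram_phi (p ^ 5)) / 2)
      + 2 * ((ram_phi q - ram_phi (q ^ 5)) / 2 * ((ram_phi p - ram_phi (p ^ 5)) / 2))
      + 2 * q ^ 8 * qtheta 1 5 2 q * qtheta 1 5 2 p + 2 * q ^ 32 * qtheta 1 5 4 q * qtheta 1 5 4 p"
    unfolding rr_U_1_39 p2(2,3) p_def[symmetric] p2(1)[symmetric]
      alg p40 alg2 rr_product_theta[OF q] rr_product_theta[OF p] rr_G_rr_G_4[OF q] rr_G_rr_G_4[OF p] ..
  also have "\<dots> = ram_phi q * ram_phi p + ram_phi (q ^ 5) * ram_phi (p ^ 5)
      + 2 * q ^ 8 * qtheta 1 5 2 q * qtheta 1 5 2 p + 2 * q ^ 32 * qtheta 1 5 4 q * qtheta 1 5 4 p"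
    by (simp add: field_simps)
  also have "\<dots> = theta_form 1 0 39 q + theta_form 5 2 8 q"
    using theta_5_2_8_split_39[OF q] theta_form_diag[OF q, of 1 39]
    by (simp add: ram_phi_eq_qtheta qtheta_power p_def)
  finally show ?thesis .
qed

text \<open>The prefactor \<open>q^3\<close> is what \<open>H(r)H(r^4)\<close> with
  \<open>r = q^3\<close> requires, and together with \<open>q^2 q^8\<close> from the two values of U
  it becomes the \<open>q^13\<close> required by \<open>H(p)H(p^4)\<close> with
  \<open>p = q^13\<close>.\<close>

lemma rr_U_3_13_4:
  assumes q: "q \<noteq> 0" "norm q < 1"
  shows "2 * q ^ 3 * euler_E (q ^ 6) * euler_E (q ^ 26) * rr_U 3 13 q * rr_U 3 13 (q ^ 4)
    = theta_form 3 0 13 q - theta_form 5 2 8 q"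
proof -
  define r where "r = q ^ 3"
  define p where "p = q ^ 13"
  have p: "p \<noteq> 0" "norm p < 1" using q norm_power_less_one[of q 13] by (auto simp: p_def)
  have r: "r \<noteq> 0" "norm r < 1" using q norm_power_less_one[of q 3] by (auto simp: r_def)
  have p2: "p\<^sup>2 = q ^ 26" "(q ^ 4) ^ 13 = p ^ 4" "r\<^sup>2 = q ^ 6" "(q ^ 4) ^ 3 = r ^ 4" "(q ^ 4) ^ 2 = q ^ 8"
    by (simp_all add: p_def r_def power_mult[symmetric])
  have p13: "q ^ 3 * q ^ 10 = p" by (simp add: p_def flip: power_add)
  have alg: "2 * r * E * E' * (h * G - q ^ 2 * g * H) * (h' * G' - q ^ 8 * g' * H')
     = 2 * (r * E * h * h') * (E' * G * G') + 2 * (E * g * g') * (p * E' * H * H')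
      - 2 * q ^ 5 * (E * g * h') * (E' * H * G') - 2 * q ^ 11 * (E * h * g') * (E' * G * H')"
    for E E' g G h H g' G' h' H' :: complex
    unfolding p13[symmetric] r_def by algebra
  have "2 * q ^ 3 * euler_E (q ^ 6) * euler_E (q ^ 26) * rr_U 3 13 q * rr_U 3 13 (q ^ 4)
     = 2 * ((ram_phi r - ram_phi (r ^ 5)) / 2) * ((ram_phi p + ram_phi (p ^ 5)) / 2)
      + 2 * ((ram_phi r + ram_phi (r ^ 5)) / 2) * ((ram_phi p - ram_phi (p ^ 5)) / 2)
      - 2 * q ^ 5 * qtheta 1 5 4 r * qtheta 1 5 2 p - 2 * q ^ 11 * qtheta 1 5 2 r * qtheta 1 5 4 p"
    unfolding rr_U_3_13 p2(2,4,5) p_def[symmetric] r_def[symmetric] p2(1,3)[symmetric]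
      alg rr_product_theta[OF r] rr_product_theta[OF p] rr_G_rr_G_4[OF r] rr_G_rr_G_4[OF p] ..
  also have "\<dots> = ram_phi r * ram_phi p - ram_phi (r ^ 5) * ram_phi (p ^ 5)
      - 2 * q ^ 5 * qtheta 1 5 4 r * qtheta 1 5 2 p - 2 * q ^ 11 * qtheta 1 5 2 r * qtheta 1 5 4 p"
    by (simp add: field_simps)
  also have "\<dots> = theta_form 3 0 13 q - theta_form 5 2 8 q"
    using theta_5_2_8_split_13[OF q] theta_form_diag[OF q, of 3 13]
    by (simp add: ram_phi_eq_qtheta qtheta_power p_def r_def)
  finally show ?thesis .
qed

lemma theta_form_at_0:
  assumes "0 < K" and "\<And>n m. n\<^sup>2 + m\<^sup>2 \<le> K * (a * n\<^sup>2 + b * n * m + c * m\<^sup>2)"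
  shows "theta_form a b c 0 = 1"
proof -
  have pos: "0 < a * n\<^sup>2 + b * n * m + c * m\<^sup>2" if "(n, m) \<noteq> (0, 0)" for n m
  proof -
    have "0 < n\<^sup>2 + m\<^sup>2" using that sum_power2_gt_zero_iff[of n m] by auto
    then have "0 < K * (a * n\<^sup>2 + b * n * m + c * m\<^sup>2)" using assms(2)[of n m] by linarith
    then show ?thesis using assms(1) zero_less_mult_pos by blast
  qed
  have "theta_form a b c 0 = infsum (\<lambda>(n, m). 0 powi (a * n\<^sup>2 + b * n * m + c * m\<^sup>2)) {(0, 0)}"
    unfolding theta_form_def
  proof (rule infsum_cong_neutral)
    fix x :: "int \<times> int" assume "x \<in> UNIV - {(0, 0)}"
    then show "(case x of (n, m) \<Rightarrow> (0::complex) powi (a * n\<^sup>2 + b * n * m + c * m\<^sup>2)) = 0"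
      using pos[of "fst x" "snd x"] by (auto simp: case_prod_unfold)
  qed auto
  then show ?thesis by simp
qed

theorem theorem4p1:
  fixes q Q :: complex
  assumes "norm q < 1" and "Q = q ^ 13"
  shows
    "2 * q ^ 2 * euler_E (q ^ 2) * euler_E (Q ^ 6) * rr_U 1 39 q * rr_U 1 39 (- q)
       = theta_form 1 1 10 q + theta_form 2 1 5 q - theta_form 1 0 39 q - theta_form 5 2 8 q
     \<and>
     2 * q ^ 2 * euler_E (q ^ 6) * euler_E (Q ^ 2) * rr_U 3 13 q * rr_U 3 13 (- q)
       = theta_form 3 0 13 q + theta_form 2 1 5 q - theta_form 3 3 4 q - theta_form 5 2 8 q
     \<and>
     (theta_form 1 0 39 q + theta_form 5 2 8 q \<noteq> 0 \<longrightarrow>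
       (theta_form 3 0 13 q - theta_form 5 2 8 q) / (theta_form 1 0 39 q + theta_form 5 2 8 q)
         = q ^ 3 * ((ram_psi (- q) * ram_psi (- (Q ^ 3))) / (ram_psi (- (q ^ 3)) * ram_psi (- Q))))
     \<and>
     (theta_form 3 0 13 q + theta_form 2 1 5 q - theta_form 3 3 4 q - theta_form 5 2 8 q \<noteq> 0 \<longrightarrow>
       (theta_form 1 1 10 q + theta_form 2 1 5 q - theta_form 1 0 39 q - theta_form 5 2 8 q)
         / (theta_form 3 0 13 q + theta_form 2 1 5 q - theta_form 3 3 4 q - theta_form 5 2 8 q)
         = (ram_phi (- (q ^ 6)) * ram_phi (- (Q ^ 2))) / (ram_phi (- (q ^ 2)) * ram_phi (- (Q ^ 6))))"
proof (cases "q = 0")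
  case True
  \<comment> \<open>Each expression is \<open>K\<close> times a form minus \<open>n^2 + m^2\<close>,
    for (1,1,10), (2,1,5), (5,2,8), (3,3,4) with \<open>K\<close> equal to 4, 2, 1, 4. At the origin
    all theta series are 1, and the denominator of the last quotient is 0.\<close>
  have sos: "0 \<le> (n + 2 * m)\<^sup>2 + 2 * n\<^sup>2 + 35 * m\<^sup>2" "0 \<le> (n + m)\<^sup>2 + 2 * n\<^sup>2 + 8 * m\<^sup>2"
    "0 \<le> (n + m)\<^sup>2 + 3 * n\<^sup>2 + 6 * m\<^sup>2" "0 \<le> 6 * (n + m)\<^sup>2 + 5 * n\<^sup>2 + 9 * m\<^sup>2" for n m :: int
    by simp_all
  have "theta_form 1 1 10 0 = 1"
    using sos(1) by (intro theta_form_at_0[of 4]) (simp_all add: power2_eq_square algebra_simps)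
  moreover have "theta_form 2 1 5 0 = 1"
    using sos(2) by (intro theta_form_at_0[of 2]) (simp_all add: power2_eq_square algebra_simps)
  moreover have "theta_form 5 2 8 0 = 1"
    using sos(3) by (intro theta_form_at_0[of 1]) (simp_all add: power2_eq_square algebra_simps)
  moreover have "theta_form 3 3 4 0 = 1"
    using sos(4) by (intro theta_form_at_0[of 4]) (simp_all add: power2_eq_square algebra_simps)
  moreover have "theta_form 1 0 39 0 = 1" "theta_form 3 0 13 0 = 1"
    by (intro theta_form_at_0[of 1]; simp)+
  ultimately show ?thesis using True by simp
next
  case False
  with assms have q: "q \<noteq> 0" "norm q < 1" by simp_all
  have qn: "q ^ n \<noteq> 0" "norm (q ^ n) < 1" if "0 < n" for n
    using q norm_power_less_one[OF q(2) that] by auto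
  have Q: "Q ^ 2 = q ^ 26" "Q ^ 3 = q ^ 39" "Q ^ 6 = q ^ 78"
    unfolding assms(2) by (simp_all add: power_mult[symmetric])
  note I = rr_U_1_39_minus[OF q] and II = rr_U_3_13_minus[OF q]
  have nz: "ram_phi (- (q ^ n)) \<noteq> 0" "ram_psi (- (q ^ n)) \<noteq> 0" if "0 < n" for n
    using ram_phi_nonzero[of "- (q ^ n)"] ram_psi_nonzero[of "- (q ^ n)"] qn[OF that] by auto
  have psi: "ram_psi (- (q ^ n)) * euler_E (q ^ (2 * n)) = euler_E (q ^ n) * euler_E (q ^ (4 * n))"
    and phi: "ram_phi (- (q ^ (2 * n))) * euler_E (q ^ (2 * n)) = euler_E (q ^ n) * euler_E (- (q ^ n))" if "0 < n" for n
    using ram_psi_minus_euler_E[OF qn[OF that]] ram_phi_minus_euler_E[OF qn[OF that]]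
    by (simp_all add: power_mult[symmetric] mult.commute)
  \<comment> \<open>Multiplying by the values of \<open>\<psi>\<close> trades each
    \<open>E(q^(2n))\<close> for \<open>E(q^n) E(q^(4n))\<close>; the product then contains one side
    of Ramanujan's relation at \<open>q\<close> and one at \<open>q^4\<close>, and both are
    exchanged.\<close>
  have "(theta_form 3 0 13 q - theta_form 5 2 8 q) * (ram_psi (- (q ^ 3)) * ram_psi (- (q ^ 13)))
      = q ^ 3 * (ram_psi (- q) * ram_psi (- (q ^ 39))) * (theta_form 1 0 39 q + theta_form 5 2 8 q)"
  proof -
    have alg1: "2 * c * E6 * E26 * u * u' * (a * b) = 2 * c * (a * E6) * (b * E26) * u * u'"
      for c E6 E26 u u' a b :: complex by algebra
    have alg2: "2 * c * (E3 * E12) * (E13 * E52) * u * u' = 2 * c * (E3 * E13 * u) * (E12 * E52 * u')"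
      for c E3 E12 E13 E52 u u' :: complex by algebra
    have alg3: "2 * c * (E1 * E39 * u) * (E4 * E156 * u') = 2 * c * (E1 * E4) * (E39 * E156) * u * u'"
      for c E1 E39 E4 E156 u u' :: complex by algebra
    have "(theta_form 3 0 13 q - theta_form 5 2 8 q) * (ram_psi (- (q ^ 3)) * ram_psi (- (q ^ 13)))
        = 2 * q ^ 3 * (ram_psi (- (q ^ 3)) * euler_E (q ^ 6)) * (ram_psi (- (q ^ 13)) * euler_E (q ^ 26)) * rr_U 3 13 q * rr_U 3 13 (q ^ 4)"
      unfolding rr_U_3_13_4[OF q, symmetric] by (rule alg1)
    also have "\<dots> = 2 * q ^ 3 * (euler_E (q ^ 3) * euler_E (q ^ 12)) * (euler_E (q ^ 13) * euler_E (q ^ 52)) * rr_U 3 13 q * rr_U 3 13 (q ^ 4)"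
      using psi[of 3] psi[of 13] by simp
    also have "\<dots> = 2 * q ^ 3 * (euler_E (q ^ 3) * euler_E (q ^ 13) * rr_U 3 13 q) * (euler_E (q ^ 12) * euler_E (q ^ 52) * rr_U 3 13 (q ^ 4))"
      by (rule alg2)
    also have "\<dots> = 2 * q ^ 3 * (euler_E q * euler_E (q ^ 39) * rr_U 1 39 q) * (euler_E (q ^ 4) * euler_E (q ^ 156) * rr_U 1 39 (q ^ 4))"
      using rr_U_1_39_eq_rr_U_3_13[OF q] rr_U_1_39_eq_rr_U_3_13[OF qn, of 4] by (simp add: power_mult[symmetric])
    also have "\<dots> = 2 * q ^ 3 * (euler_E q * euler_E (q ^ 4)) * (euler_E (q ^ 39) * euler_E (q ^ 156)) * rr_U 1 39 q * rr_U 1 39 (q ^ 4)"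
      by (rule alg3)
    also have "\<dots> = 2 * q ^ 3 * (ram_psi (- q) * euler_E (q ^ 2)) * (ram_psi (- (q ^ 39)) * euler_E (q ^ 78)) * rr_U 1 39 q * rr_U 1 39 (q ^ 4)"
      using psi[of 1] psi[of 39] by simp
    also have "\<dots> = q ^ 3 * (ram_psi (- q) * ram_psi (- (q ^ 39))) * (theta_form 1 0 39 q + theta_form 5 2 8 q)"
      unfolding rr_U_1_39_4[OF q, symmetric] by (simp only: mult_ac)
    finally show ?thesis .
  qed
  then have III: "(theta_form 3 0 13 q - theta_form 5 2 8 q) / (theta_form 1 0 39 q + theta_form 5 2 8 q)
         = q ^ 3 * ((ram_psi (- q) * ram_psi (- (Q ^ 3))) / (ram_psi (- (q ^ 3)) * ram_psi (- Q)))"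
    if "theta_form 1 0 39 q + theta_form 5 2 8 q \<noteq> 0"
    using that nz(2)[of 3] nz(2)[of 13] unfolding Q assms(2) by (simp add: frac_eq_eq)
  \<comment> \<open>The same exchange with \<open>\<phi>\<close>: each \<open>E(q^(2n))\<close>
    becomes \<open>E(q^n) E(-q^n)\<close>, and Ramanujan's relation is used at \<open>q\<close> and
    at \<open>-q\<close>.\<close>
  have "(2 * q ^ 2 * euler_E (q ^ 2) * euler_E (q ^ 78) * rr_U 1 39 q * rr_U 1 39 (- q)) * (ram_phi (- (q ^ 2)) * ram_phi (- (q ^ 78)))
      = (ram_phi (- (q ^ 6)) * ram_phi (- (q ^ 26))) * (2 * q ^ 2 * euler_E (q ^ 6) * euler_E (q ^ 26) * rr_U 3 13 q * rr_U 3 13 (- q))"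
  proof -
    have alg: "(2 * c * E * E' * u * u') * (a * b) = 2 * c * (a * E) * (b * E') * u * u'"
      for c E E' u u' a b :: complex by algebra
    have alg': "2 * c * (E * E') * (F * F') * u * u' = 2 * c * (E * F * u) * (E' * F' * u')"
      for c E E' F F' u u' :: complex by algebra
    have "(2 * q ^ 2 * euler_E (q ^ 2) * euler_E (q ^ 78) * rr_U 1 39 q * rr_U 1 39 (- q)) * (ram_phi (- (q ^ 2)) * ram_phi (- (q ^ 78)))
        = 2 * q ^ 2 * (euler_E q * euler_E (q ^ 39) * rr_U 1 39 q) * (euler_E (- q) * euler_E (- (q ^ 39)) * rr_U 1 39 (- q))"
      unfolding alg alg'[symmetric] using phi[of 1] phi[of 39] by simp
    also have "\<dots> = 2 * q ^ 2 * (euler_E (q ^ 3) * euler_E (q ^ 13) * rr_U 3 13 q) * (euler_E (- (q ^ 3)) * euler_E (- (q ^ 13)) * rr_U 3 13 (- q))"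
      using rr_U_1_39_eq_rr_U_3_13[OF q] rr_U_1_39_eq_rr_U_3_13[of "- q"] q by simp
    also have "\<dots> = (2 * q ^ 2 * euler_E (q ^ 6) * euler_E (q ^ 26) * rr_U 3 13 q * rr_U 3 13 (- q)) * (ram_phi (- (q ^ 6)) * ram_phi (- (q ^ 26)))"
      unfolding alg alg'[symmetric] using phi[of 3] phi[of 13] by simp
    finally show ?thesis by (simp only: mult.commute)
  qed
  then have IV: "(theta_form 1 1 10 q + theta_form 2 1 5 q - theta_form 1 0 39 q - theta_form 5 2 8 q)
         / (theta_form 3 0 13 q + theta_form 2 1 5 q - theta_form 3 3 4 q - theta_form 5 2 8 q)
         = (ram_phi (- (q ^ 6)) * ram_phi (- (Q ^ 2))) / (ram_phi (- (q ^ 2)) * ram_phi (- (Q ^ 6)))"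
    if "theta_form 3 0 13 q + theta_form 2 1 5 q - theta_form 3 3 4 q - theta_form 5 2 8 q \<noteq> 0"
    unfolding Q I II using that nz(1)[of 2] nz(1)[of 78] by (simp add: frac_eq_eq)
  show ?thesis unfolding Q(1,3) using I II III IV[unfolded Q(1,3)] by blast
qed

end
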